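(* For every triangle $ABC$, the triangles $ABC$ and $BCA$ are equal triangles.
   Context: Setting: elementary (synthetic) Euclidean plane geometry, as axiomatized for example by Hilbert or Tarski, with the Euclidean parallel postulate and line-circle continuity; Archimedes' axiom is not assumed. $\mathbf{B}(X,Y,Z)$ means $Y$ lies strictly between $X$ and $Z$. For segments, "$=$" means congruence. A rectangle is given by an ordered list $PQRS$ of its vertices going around it; its base (width) is $PQ$ and its height is $QR$. Rectangles $PQRS$ and $pqrs$ are congruent if $PQ=pq$ and $QR=qr$. Equal rectangles: given rectangles $R$ and $S$, place congruent copies of them as $FEBG$ (congruent to $R$) and $BMLA$ (congruent to $S$) with $\mathbf{B}(A,B,E)$ and $\mathbf{B}(G,B,M)$, and let $H,K$ be the points such that $ABGH$ and $BMKE$ are rectangles. Then $R$ and $S$ are equal rectangles if and only if $\mathbf{B}(H,B,K)$. A triangle is an ordered triple of non-collinear points; the base of triangle $ABC$ is $AB$. The first circumscribed rectangle of triangle $ABC$ is the rectangle $ABDK$ such that $C$ lies on the line through $D$ and $K$ (the triangle need not lie inside the rectangle). Two triangles are equal triangles if their first circumscribed rectangles are equal rectangles. *)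

theory Defs
  imports Main
begin

text \<open>
  Tarski's axioms for elementary plane geometry, with the Euclidean parallel axiom and
  line-circle continuity.  There is no continuity schema and no Archimedean axiom.
  The primitive \<open>bet\<close> is Tarski's non-strict betweenness; \<open>cong A B C D\<close> says that the
  segments \<open>AB\<close> and \<open>CD\<close> are congruent.
\<close>

locale euclidean_plane =
  fixes bet :: "'p \<Rightarrow> 'p \<Rightarrow> 'p \<Rightarrow> bool"
    and cong :: "'p \<Rightarrow> 'p \<Rightarrow> 'p \<Rightarrow> 'p \<Rightarrow> bool"
  assumes cong_pseudo_reflexivity: "cong A B B A"
    and cong_inner_transitivity: "\<lbrakk>cong A B C D; cong A B E F\<rbrakk> \<Longrightarrow> cong C D E F"
    and cong_identity: "cong A B C C \<Longrightarrow> A = B"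
    and segment_construction: "\<exists>E. bet A B E \<and> cong B E C D"
    and five_segment:
      "\<lbrakk>A \<noteq> B; bet A B C; bet A' B' C'; cong A B A' B'; cong B C B' C';
        cong A D A' D'; cong B D B' D'\<rbrakk> \<Longrightarrow> cong C D C' D'"
    and bet_identity: "bet A B A \<Longrightarrow> A = B"
    and inner_pasch: "\<lbrakk>bet A P C; bet B Q C\<rbrakk> \<Longrightarrow> \<exists>X. bet P X B \<and> bet Q X A"
    and lower_dimension: "\<exists>A B C. \<not> bet A B C \<and> \<not> bet B C A \<and> \<not> bet C A B"
    and upper_dimension:
      "\<lbrakk>P \<noteq> Q; cong A P A Q; cong B P B Q; cong C P C Q\<rbrakk>
        \<Longrightarrow> bet A B C \<or> bet B C A \<or> bet C A B"
    and parallel_axiom: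
      "\<lbrakk>bet A D T; bet B D C; A \<noteq> D\<rbrakk> \<Longrightarrow> \<exists>X Y. bet A B X \<and> bet A C Y \<and> bet X T Y"
    \<comment> \<open>\<open>P\<close> is strictly inside the circle with centre \<open>O'\<close> through \<open>E\<close>; every line \<open>PQ\<close> through
      \<open>P\<close> meets the circle in points \<open>X\<close> and \<open>Y\<close> on opposite sides of \<open>P\<close>.\<close>
    and line_circle_continuity:
      "\<lbrakk>bet O' P E; P \<noteq> E; P \<noteq> Q\<rbrakk>
        \<Longrightarrow> \<exists>X Y. cong O' X O' E \<and> cong O' Y O' E \<and> bet X P Y
              \<and> (bet P Q X \<or> bet Q X P \<or> bet X P Q)
              \<and> (bet P Q Y \<or> bet Q Y P \<or> bet Y P Q)"
begin

definition between :: "'p \<Rightarrow> 'p \<Rightarrow> 'p \<Rightarrow> bool" where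
  "between X Y Z \<longleftrightarrow> bet X Y Z \<and> X \<noteq> Y \<and> Y \<noteq> Z"

definition collinear :: "'p \<Rightarrow> 'p \<Rightarrow> 'p \<Rightarrow> bool" where
  "collinear X Y Z \<longleftrightarrow> bet X Y Z \<or> bet Y Z X \<or> bet Z X Y"

text \<open>
  The angle \<open>XYZ\<close> is right if it equals its supplement: for the reflection \<open>W\<close> of \<open>X\<close> in
  \<open>Y\<close>, the triangles \<open>XYZ\<close> and \<open>WYZ\<close> have equal sides.
\<close>

definition right_angle :: "'p \<Rightarrow> 'p \<Rightarrow> 'p \<Rightarrow> bool" where
  "right_angle X Y Z \<longleftrightarrow>
     Y \<noteq> Z \<and> (\<exists>W. between X Y W \<and> cong X Y W Y \<and> cong X Z W Z)"

definition rectangle :: "'p \<Rightarrow> 'p \<Rightarrow> 'p \<Rightarrow> 'p \<Rightarrow> bool" where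
  "rectangle P Q R S \<longleftrightarrow>
     right_angle S P Q \<and> right_angle P Q R \<and> right_angle Q R S \<and> right_angle R S P"

definition congruent_rectangles ::
  "'p \<Rightarrow> 'p \<Rightarrow> 'p \<Rightarrow> 'p \<Rightarrow> 'p \<Rightarrow> 'p \<Rightarrow> 'p \<Rightarrow> 'p \<Rightarrow> bool" where
  "congruent_rectangles P Q R S p q r s \<longleftrightarrow>
     rectangle P Q R S \<and> rectangle p q r s \<and> cong P Q p q \<and> cong Q R q r"

text \<open>
  Equality of the rectangles \<open>PQRS\<close> and \<open>pqrs\<close>.  The congruent copies \<open>FEBG\<close> and \<open>BMLA\<close>
  lie in opposite quadrants at \<open>B\<close>, and \<open>ABGH\<close> and \<open>BMKE\<close> fill the other two quadrants.
  Such a configuration is unique up to isometry, so it may be quantified existentially.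
\<close>

definition equal_rectangles ::
  "'p \<Rightarrow> 'p \<Rightarrow> 'p \<Rightarrow> 'p \<Rightarrow> 'p \<Rightarrow> 'p \<Rightarrow> 'p \<Rightarrow> 'p \<Rightarrow> bool" where
  "equal_rectangles P Q R S p q r s \<longleftrightarrow>
     (\<exists>A B E F G H K L M.
        congruent_rectangles P Q R S F E B G \<and>
        congruent_rectangles p q r s B M L A \<and>
        between A B E \<and> between G B M \<and>
        rectangle A B G H \<and> rectangle B M K E \<and>
        between H B K)"

definition triangle :: "'p \<Rightarrow> 'p \<Rightarrow> 'p \<Rightarrow> bool" where
  "triangle A B C \<longleftrightarrow> \<not> collinear A B C"

text \<open>\<open>ABDK\<close> is the first circumscribed rectangle of the triangle \<open>ABC\<close>; the line
  \<open>DK\<close> passes through \<open>C\<close>, but the triangle need not lie inside it.\<close>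

definition first_circumscribed_rectangle ::
  "'p \<Rightarrow> 'p \<Rightarrow> 'p \<Rightarrow> 'p \<Rightarrow> 'p \<Rightarrow> bool" where
  "first_circumscribed_rectangle A B C D K \<longleftrightarrow>
     triangle A B C \<and> rectangle A B D K \<and> collinear C D K"

definition equal_triangles ::
  "'p \<Rightarrow> 'p \<Rightarrow> 'p \<Rightarrow> 'p \<Rightarrow> 'p \<Rightarrow> 'p \<Rightarrow> bool" where
  "equal_triangles A B C a b c \<longleftrightarrow>
     (\<exists>D K d k. first_circumscribed_rectangle A B C D K \<and>
                first_circumscribed_rectangle a b c d k \<and>
                equal_rectangles A B D K a b d k)"

end

end

theory Submission
  imports Defs
begin

text \<open>
  Let \<open>a = BC\<close> and \<open>c = BA\<close>, and let \<open>h\<close> and \<open>k\<close> be the heights of the triangle from \<open>A\<close> and from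
  \<open>C\<close>.  The two first circumscribed rectangles have sides \<open>c, k\<close> and \<open>a, h\<close>.  When copies of them
  are placed in opposite quadrants at a point, the far corners of the other two quadrants are at
  \<open>(-c, -h)\<close> and \<open>(a, k)\<close>, so the rectangles are equal iff the slopes \<open>h : c\<close> and \<open>k : a\<close>
  agree.  Both are the sine of the angle at \<open>B\<close>.

  The proof makes sense of this without numbers, ratios or similar triangles.  Take \<open>B\<close> as origin;
  the points of the plane become the vectors of an abelian group on which the isometries fixing
  \<open>B\<close> act by automorphisms.  Let \<open>r\<close> be the rotation that turns the ray \<open>BC\<close> into the ray
  \<open>BA\<close>.  For \<open>x\<close> on the line \<open>BC\<close> the vector \<open>N x = (r x - r\<^sup>-\<^sup>1 x) / 2\<close> is the height of
  \<open>r x\<close> over that line: multiplication by the sine, followed by a quarter turn.  If \<open>v\<close> is the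
  vector of length \<open>c\<close> on the ray \<open>BC\<close> and \<open>w = C\<close>, then \<open>N v\<close> is the height from \<open>A\<close>, while
  \<open>N w\<close> is congruent to the height from \<open>C\<close>, by the reflection that exchanges the two rays.  With
  \<open>U = id + N\<close> the two far corners are \<open>- U v\<close> and \<open>U w\<close>.  It remains to see that \<open>U\<close> maps
  vectors on one line through \<open>B\<close> to vectors on one line through \<open>B\<close>.

  The reason is that \<open>U\<close> is additive and commutes with all rotations.  If \<open>w\<close> lies on the line of
  \<open>v\<close> and is no longer than \<open>v\<close>, then \<open>w = t v + t\<^sup>-\<^sup>1 v\<close> for a rotation \<open>t\<close>; hence
  \<open>U w = t (U v) + t\<^sup>-\<^sup>1 (U v)\<close>, which is invariant under the reflection in the line of \<open>U v\<close>, so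
  it lies on that line (lemma \<open>rotation_commuting_preserves_lines\<close>).  If \<open>w\<close> is longer than \<open>v\<close>,
  exchange the two.

  What has to be derived from the axioms is therefore: existence of midpoints and of reflections in
  lines (\<open>midpoint_exists\<close>, \<open>isometry_mirror\<close>); the product of three half-turns is a half-turn,
  which yields the group of vectors (\<open>three_half_turns\<close>; it rests on the uniqueness of parallels,
  \<open>playfair\<close>); and the rotations about a point commute (\<open>direct_commute\<close>).  That the common corner
  lies \<^emph>\<open>between\<close> the far corners follows from the fact that a line separates the plane
  (\<open>pasch\<close>).
\<close>

section \<open>Congruence and betweenness\<close>

context euclidean_plane begin

text \<open>
  The congruence class of a segment, as a set of pairs.  It turns congruence into equality of
  values, so that facts about congruent segments can be used by rewriting.
\<close>

definition len where "len A B = {(C, D). cong A B C D}"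

lemma cong_refl: "cong A B A B"
  by (rule cong_inner_transitivity[OF cong_pseudo_reflexivity cong_pseudo_reflexivity])

lemma cong_iff_len: "cong A B C D \<longleftrightarrow> len A B = len C D"
proof
  assume c: "cong A B C D"
  have "cong A B X Y \<longleftrightarrow> cong C D X Y" for X Y
    by (rule iffI, erule cong_inner_transitivity[OF c],
        erule cong_inner_transitivity[OF cong_inner_transitivity[OF c cong_refl]])
  then show "len A B = len C D" by (simp add: len_def)
next
  assume "len A B = len C D"
  then have "(C, D) \<in> len A B" by (simp add: len_def cong_refl)
  then show "cong A B C D" by (simp add: len_def)
qed

lemma len_commute: "len A B = len B A"
  using cong_pseudo_reflexivity cong_iff_len by blast

lemma len_flip: "len A B = len C D \<Longrightarrow> len B A = len D C"
  by (simp only: len_commute[of B A] len_commute[of D C])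

lemma extend: obtains E where "bet A B E" "len B E = len C D"
  using segment_construction[of A B C D] cong_iff_len by blast

lemma len_null: "len A A = len B B"
  by (metis extend cong_identity cong_iff_len)

lemma len_eq_null [simp]: "len A B = len C C \<longleftrightarrow> A = B"
  by (metis cong_identity cong_iff_len len_null)

lemma len_eq_null' [simp]: "len C C = len A B \<longleftrightarrow> A = B"
  by (metis len_eq_null)

lemma five_segment_len:
  assumes "A \<noteq> B" "bet A B C" "bet A' B' C'" "len A B = len A' B'" "len B C = len B' C'"
    "len A D = len A' D'" "len B D = len B' D'"
  shows "len C D = len C' D'"
  using five_segment[of A B C A' B' C' D D'] assms by (simp add: cong_iff_len)

lemma bet_refl_right [simp]: "bet A B B"
  by (metis extend len_eq_null)

lemma bet_sym: "bet A B C \<Longrightarrow> bet C B A"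
  by (metis inner_pasch bet_refl_right bet_identity)

lemma bet_refl_left [simp]: "bet A A B"
  using bet_sym by simp

lemma bet_antisym: "bet A B C \<Longrightarrow> bet B A C \<Longrightarrow> A = B"
  by (metis inner_pasch bet_identity)

lemma bet_inner_trans: "bet A B D \<Longrightarrow> bet B C D \<Longrightarrow> bet A B C"
  by (metis inner_pasch bet_identity bet_sym)

lemma bet_exchange: "bet A B C \<Longrightarrow> bet A C D \<Longrightarrow> bet B C D"
  using bet_inner_trans[of D C A B] bet_sym by blast

lemma len_add:
  assumes "bet A B C" "bet A' B' C'" "len A B = len A' B'" "len B C = len B' C'"
  shows "len A C = len A' C'"
proof (cases "A = B")
  case True
  then have "A' = B'" using assms(3) by simp
  then show ?thesis using True assms(4) by simp
next
  case False
  have "len C A = len C' A'"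
    by (rule five_segment_len[OF False assms]) (simp_all add: len_null len_commute assms)
  then show ?thesis by (simp only: len_commute)
qed

lemma extend_unique:
  assumes "A \<noteq> B" "bet A B C" "bet A B D" "len B C = len B D"
  shows "C = D"
  using five_segment_len[of A B C A B C C D] len_add[of A B C A B D] assms by simp

lemma bet_outer_trans:
  assumes "bet A B C" "bet B C D" "B \<noteq> C" shows "bet A C D"
  by (metis assms extend bet_exchange extend_unique)

lemma bet_outer_trans':
  assumes "bet A B C" "bet B C D" "B \<noteq> C" shows "bet A B D"
  by (metis assms bet_sym bet_outer_trans)

lemma bet_trans: "bet A B D \<Longrightarrow> bet B C D \<Longrightarrow> bet A C D"
  by (metis bet_inner_trans bet_outer_trans)

lemma bet_trans': "bet A B C \<Longrightarrow> bet A C D \<Longrightarrow> bet A B D"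
  by (metis bet_sym bet_trans)

text \<open>
  Extending both segments beyond \<open>C\<close> and \<open>C'\<close> reduces the statement to two applications of the
  five-segment axiom, the second of them from the outside inwards.
\<close>

lemma inner_five_segment:
  assumes "bet A B C" "bet A' B' C'" "len A C = len A' C'" "len B C = len B' C'"
    "len A D = len A' D'" "len C D = len C' D'"
  shows "len B D = len B' D'"
proof (cases "A = C")
  case True
  then have "A' = C'" using assms(3) by simp
  then show ?thesis using True assms bet_identity by blast
next
  case False
  obtain E where E: "bet A C E" "len C E = len A C" using extend .
  obtain E' where E': "bet A' C' E'" "len C' E' = len C E" using extend .
  have "len E D = len E' D'"
    by (rule five_segment_len[OF False E(1) E'(1) assms(3)]) (simp_all only: E E' assms)
  moreover have "E \<noteq> C" using E False by auto
  moreover have "bet E C B" "bet E' C' B'" using E E' assms bet_exchange bet_sym by blast+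
  ultimately show ?thesis
    using five_segment_len[of E C B E' C' B' D D'] by (metis E E' assms len_commute)
qed

lemma bet_transfer_ex:
  assumes "bet A B C" "len A C = len A' C'"
  obtains B' where "bet A' B' C'" "len A B = len A' B'" "len B C = len B' C'"
proof (cases "A' = C'")
  case True
  then have "A = C" using assms(2) by auto
  then have "A = B" using assms(1) bet_identity by auto
  then show ?thesis using that[of A'] True assms by auto
next
  case False
  obtain D where D: "bet C' A' D" "len A' D = len C' A'" using extend .
  have nz: "D \<noteq> A'" using D False by auto
  obtain B' where B': "bet D A' B'" "len A' B' = len A B" using extend .
  obtain C'' where C'': "bet D B' C''" "len B' C'' = len B C" using extend .
  have b: "bet A' B' C''" using B' C'' bet_exchange by blast
  then have "len A' C'' = len A' C'" using len_add[OF b assms(1)] B' C'' assms by simp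
  moreover have "bet D A' C''" using B' C'' bet_trans' by blast
  ultimately have "C'' = C'" using extend_unique[of D A' C'' C'] nz D bet_sym by simp
  then show ?thesis using that[of B'] b B' C'' by simp
qed

lemma bet_cong:
  assumes "bet A B C" "len A B = len A' B'" "len A C = len A' C'" "len B C = len B' C'"
  shows "bet A' B' C'"
proof -
  obtain X where X: "bet A' X C'" "len A B = len A' X" "len B C = len X C'"
    using bet_transfer_ex[OF assms(1,3)] .
  have "len B B = len X B'"
    by (rule inner_five_segment[OF assms(1) X(1) assms(3)]) (metis X assms len_commute)+
  then show ?thesis using X by simp
qed

lemma col_refl [simp]: "collinear A A B" "collinear A B B" "collinear A B A"
  unfolding collinear_def by auto

lemma col_rot: "collinear A B C \<Longrightarrow> collinear B C A"
  and col_swap: "collinear A B C \<Longrightarrow> collinear B A C"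
  unfolding collinear_def using bet_sym by blast+

lemma col_five_segment:
  assumes "collinear A B C" "A \<noteq> B" "len A B = len A' B'" "len A C = len A' C'"
    "len B C = len B' C'" "len A D = len A' D'" "len B D = len B' D'"
  shows "len C D = len C' D'"
proof -
  note l = assms(3-7) assms(3-7)[THEN len_flip]
  consider "bet A B C" | "bet B C A" | "bet C A B" using assms(1) unfolding collinear_def by blast
  then show ?thesis
  proof cases
    case 1
    show ?thesis by (rule five_segment_len[OF assms(2) 1 bet_cong[OF 1]]) (fact assms)+
  next
    case 2
    have "bet B' C' A'" by (rule bet_cong[OF 2]) (fact l)+
    then show ?thesis by (rule inner_five_segment[OF 2]) (fact l)+
  next
    case 3
    then have b: "bet B A C" using bet_sym by blast
    have "bet B' A' C'" by (rule bet_cong[OF b]) (fact l)+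
    then show ?thesis by (rule five_segment_len[OF assms(2)[symmetric] b]) (fact l)+
  qed
qed

lemma equidistant_on_line:
  assumes "A \<noteq> B" "collinear A B C" "len A P = len A Q" "len B P = len B Q"
  shows "len C P = len C Q"
  using col_five_segment[of A B C A B C P Q] assms by simp

lemma col_point_determined:
  assumes "A \<noteq> B" "collinear A B C" "len A C = len A D" "len B C = len B D"
  shows "C = D"
  using equidistant_on_line[OF assms] by simp

lemma equidistant_imp_col:
  assumes "P \<noteq> Q" "len A P = len A Q" "len B P = len B Q" "len C P = len C Q"
  shows "collinear A B C"
  using upper_dimension[of P Q A B C] assms cong_iff_len collinear_def by auto

lemma col_cong:
  assumes "collinear A B C" "len A B = len A' B'" "len A C = len A' C'" "len B C = len B' C'"
  shows "collinear A' B' C'"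
proof -
  note l = assms(2-4) assms(2-4)[THEN len_flip]
  consider "bet A B C" | "bet B C A" | "bet C A B" using assms(1) unfolding collinear_def by blast
  then show ?thesis
  proof cases
    case 1
    have "bet A' B' C'" by (rule bet_cong[OF 1]) (fact l)+
    then show ?thesis by (simp add: collinear_def)
  next
    case 2
    have "bet B' C' A'" by (rule bet_cong[OF 2]) (fact l)+
    then show ?thesis by (simp add: collinear_def)
  next
    case 3
    have "bet C' A' B'" by (rule bet_cong[OF 3]) (fact l)+
    then show ?thesis by (simp add: collinear_def)
  qed
qed

text \<open>
  Prolonging \<open>AD\<close> and \<open>AC\<close> by \<open>CD\<close> gives a rhombus \<open>C D C' D'\<close>, whose diagonals bisect each
  other at \<open>E\<close>; the claim is that one of them has length zero.  Otherwise there are points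
  \<open>P\<close> and \<open>Q\<close> such that all points of the line are equidistant from \<open>P\<close> and \<open>Q\<close>.  As \<open>P\<close>
  lies on the prolonged diagonal \<open>C'C\<close>, this includes \<open>P\<close>, so \<open>P = Q\<close>, against the lengths.
\<close>

lemma bet_connect_outer:
  assumes "A \<noteq> B" "bet A B C" "bet A B D"
  shows "bet A C D \<or> bet A D C"
proof -
  \<comment> \<open>\<open>B'\<close> and \<open>B''\<close> close the figure symmetrically to \<open>B\<close>; comparing lengths shows that they coincide.\<close>
  obtain C' where C': "bet A D C'" "len D C' = len C D" using extend .
  obtain D' where D': "bet A C D'" "len C D' = len C D" using extend .
  obtain B' where B': "bet A C' B'" "len C' B' = len C B" using extend .
  obtain B'' where B'': "bet A D' B''" "len D' B'' = len D B" using extend .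
  have b1: "bet B C D'" "bet B D C'" "bet A B C'" "bet A B D'"
    using bet_exchange[OF assms(2) D'(1)] bet_exchange[OF assms(3) C'(1)]
      bet_trans'[OF assms(3) C'(1)] bet_trans'[OF assms(2) D'(1)] by auto
  have b2: "bet B C' B'" "bet B D' B''" "bet A B B'" "bet A B B''"
    using bet_exchange[OF b1(3) B'(1)] bet_exchange[OF b1(4) B''(1)]
      bet_trans'[OF b1(3) B'(1)] bet_trans'[OF b1(4) B''(1)] by auto
  have b3: "bet C D' B''" "bet D C' B'"
    using bet_exchange[OF b1(1) b2(2)] bet_exchange[OF b1(2) b2(1)] by auto
  have b4: "bet B C B''" using bet_trans'[OF b1(1) b2(2)] .
  have l1: "len B C' = len B'' C"
    by (rule len_add[OF b1(2) bet_sym[OF b3(1)]]) (metis B''(2) C'(2) D'(2) len_commute)+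
  have l2: "len B B' = len B'' B"
    by (rule len_add[OF b2(1) bet_sym[OF b4]]) (simp_all only: l1 B'(2))
  have eB: "B'' = B'" using extend_unique[of A B B'' B'] b2 l2 assms len_commute by metis
  have l3: "len D' C' = len D C"
  proof (cases "B = C")
    case True
    then show ?thesis
      using l1 eB B' C' D' B''
      by (metis bet_identity b2 l2 len_eq_null len_commute)
  next
    case False
    have "len C D' = len C' D" "len B C = len B' C'" "len B C' = len B' C" using C' D' B' l1 eB len_commute by metis+
    moreover have "bet B' C' D" using b3 bet_sym by blast
    ultimately show ?thesis
      using five_segment_len[of B C D' B' C' D C' C] False b1 len_commute by metis
  qed
  obtain E where E: "bet C E C'" "bet D E D'"
    using inner_pasch[of C D' B' D C'] b3 eB bet_sym by (metis)
  have l4: "len E C = len E C'"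
    using inner_five_segment[of D E D' D E D' C C'] E C' D' l3 len_commute by metis
  have l5: "len E D = len E D'"
    using inner_five_segment[of C E C' C E C' D D'] E C' D' l3 len_commute by metis
  have "C = C' \<or> D = D'"
  proof (rule ccontr)
    assume "\<not> ?thesis"
    then have n: "C \<noteq> C'" "D \<noteq> D'" by auto
    have nCD': "C \<noteq> D'"
      using n D' C' by (metis len_eq_null)
    have nE: "E \<noteq> C" "E \<noteq> D" using l4 l5 n by auto
    obtain P where P: "bet C' C P" "len C P = len C D'" using extend .
    obtain R where R: "bet D' C R" "len C R = len C E" using extend .
    obtain Q where Q: "bet P R Q" "len R Q = len R P" using extend .
    have bP: "bet P C E" using P E bet_exchange bet_sym by blast
    have m1: "len R P = len E D'"
      using five_segment_len[of D' C R P C E P D'] nCD' R bP P len_commute by metis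
    have m2: "len R Q = len E D" using m1 Q l5 len_commute by metis
    have m3: "len D' E = len P R" using m1 len_commute by metis
    have nDE: "D' \<noteq> E" using l5 nE by auto
    have m4: "len D C = len Q C"
      using five_segment_len[of D' E D P R Q C C] nDE E Q m3 m2 P R len_commute bet_sym by metis
    have m5: "len C P = len C Q" using m4 P D' len_commute by metis
    have m6: "len R P = len R Q" using Q by simp
    have nRC: "R \<noteq> C" using R nE by auto
    have m7: "len D' P = len D' Q"
      using equidistant_on_line[of R C D' P Q] nRC m5 m6 R bet_sym collinear_def by metis
    have m8: "len B P = len B Q"
      using equidistant_on_line[of C D' B P Q] nCD' m5 m7 b1 collinear_def by metis
    have m9: "len B' P = len B' Q"
      using equidistant_on_line[of C D' B' P Q] nCD' m5 m7 b3 eB collinear_def by metis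
    have nBB': "B \<noteq> B'" using b2 b4 eB nCD' b3 bet_identity b1 by metis
    have m10: "len C' P = len C' Q"
      using equidistant_on_line[of B B' C' P Q] nBB' m8 m9 b2 bet_sym collinear_def by metis
    have "len P P = len P Q"
      using equidistant_on_line[of C' C P P Q] n m5 m10 P collinear_def by metis
    then have "P = Q" by simp
    then have "R = P" using Q bet_identity by metis
    then show False using m1 nDE by simp
  qed
  then show ?thesis using C' D' by blast
qed

lemma bet_connect:
  assumes "A \<noteq> B" "bet A B C" "bet A B D"
  shows "bet B C D \<or> bet B D C"
  using bet_connect_outer[OF assms] assms bet_exchange by blast

lemma bet_connect_inner:
  assumes "bet A B D" "bet A C D"
  shows "bet A B C \<or> bet A C B"
proof (cases "A = D")
  case True
  then show ?thesis using assms bet_identity by auto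
next
  case False
  obtain E where E: "bet D A E" "len A E = len D A" using extend .
  have "E \<noteq> A" using E False by auto
  moreover have "bet E A B" "bet E A C" using E assms bet_sym bet_inner_trans bet_exchange by metis+
  ultimately show ?thesis using bet_connect by blast
qed

lemma col_trans:
  assumes "A \<noteq> B" "collinear A B C" "collinear A B D"
  shows "collinear A C D"
proof -
  have "bet A C D \<or> bet A D C \<or> bet C A D"
  proof -
    consider "bet A B C" | "bet A C B" | "bet C A B" using assms(2) bet_sym unfolding collinear_def by blast
    then show ?thesis
    proof cases
      case 1
      consider "bet A B D" | "bet A D B" | "bet D A B" using assms(3) bet_sym unfolding collinear_def by blast
      then show ?thesis
        using 1 assms(1) bet_connect_outer bet_trans' bet_outer_trans' bet_sym by cases blast+
    next
      case 2
      consider "bet A B D" | "bet A D B" | "bet D A B" using assms(3) bet_sym unfolding collinear_def by blast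
      then show ?thesis
        using 2 assms(1) bet_connect_inner bet_trans' bet_inner_trans bet_sym by cases blast+
    next
      case 3
      consider "bet A B D" | "bet A D B" | "bet D A B" using assms(3) bet_sym unfolding collinear_def by blast
      then show ?thesis
      proof cases
        case 3
        then show ?thesis using \<open>bet C A B\<close> bet_connect[of B A C D] bet_sym assms(1) by blast
      qed (use 3 assms(1) bet_outer_trans' bet_inner_trans in blast)+
    qed
  qed
  then show ?thesis unfolding collinear_def using bet_sym by blast
qed


section \<open>Half-turns and isometries\<close>

definition half_turn where
  "half_turn M A = (SOME B. bet A M B \<and> len M B = len M A)"

lemma half_turn_bet: "bet A M (half_turn M A)"
  and half_turn_len: "len M (half_turn M A) = len M A"
proof -
  have "\<exists>B. bet A M B \<and> len M B = len M A" using extend[of A M M A] by blast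
  then have "bet A M (half_turn M A) \<and> len M (half_turn M A) = len M A"
    unfolding half_turn_def by (rule someI_ex)
  then show "bet A M (half_turn M A)" "len M (half_turn M A) = len M A" by auto
qed

lemma half_turn_eqI:
  assumes "bet A M B" "len M B = len M A" shows "half_turn M A = B"
proof (cases "A = M")
  case True
  then have "M = B" "half_turn M A = M" using assms half_turn_len[of M A] by auto
  then show ?thesis by simp
next
  case False
  show ?thesis
    by (rule extend_unique[OF False half_turn_bet assms(1)]) (simp only: half_turn_len assms(2))
qed

lemma half_turn_half_turn [simp]: "half_turn M (half_turn M A) = A"
  by (rule half_turn_eqI) (simp_all only: half_turn_len half_turn_bet bet_sym)

lemma half_turn_center [simp]: "half_turn M M = M"
  by (rule half_turn_eqI) simp_all

lemma half_turn_fix [simp]: "half_turn M A = A \<longleftrightarrow> A = M"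
  using half_turn_bet[of A M] bet_identity by auto

lemma half_turn_eq_center [simp]: "half_turn M A = M \<longleftrightarrow> A = M"
  by (metis half_turn_center half_turn_half_turn)

lemma half_turn_col: "collinear A M (half_turn M A)"
  using half_turn_bet collinear_def by auto

text \<open>
  Prolonging \<open>AA'\<close> by \<open>BM\<close> and \<open>BB'\<close> by \<open>AM\<close> at both ends gives two segments with the same
  length and the same midpoint \<open>M\<close>.  Their end points form a figure with equal opposite sides, from
  which \<open>A\<close> and \<open>B\<close> are reached by cutting off equal pieces.
\<close>

lemma half_turn_iso: "len (half_turn M A) (half_turn M B) = len A B"
proof (cases "A = M \<or> B = M")
  case True
  then show ?thesis using half_turn_len len_commute half_turn_center by metis
next
  case False
  define A' B' where "A' = half_turn M A" and "B' = half_turn M B"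
  have a: "bet A M A'" "len M A' = len M A" and b: "bet B M B'" "len M B' = len M B"
    by (simp_all only: A'_def B'_def half_turn_bet half_turn_len)
  obtain X where X: "bet A' A X" "len A X = len M B" using extend .
  obtain X' where X': "bet A A' X'" "len A' X' = len M B" using extend .
  obtain Y where Y: "bet B' B Y" "len B Y = len M A" using extend .
  obtain Y' where Y': "bet B B' Y'" "len B' Y' = len M A" using extend .
  have m: "bet M A X" "bet M A' X'" "bet M B Y" "bet M B' Y'"
    using bet_exchange[OF bet_sym[OF a(1)] X(1)] bet_exchange[OF a(1) X'(1)]
      bet_exchange[OF bet_sym[OF b(1)] Y(1)] bet_exchange[OF b(1) Y'(1)] by auto
  have "A \<noteq> M" "A' \<noteq> M" "B \<noteq> M" "B' \<noteq> M" using False a b by auto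
  have "bet A M X'" by (rule bet_trans'[OF a(1) X'(1)])
  then have x: "bet X M X'"
    using bet_outer_trans[OF bet_sym[OF m(1)]] \<open>A \<noteq> M\<close> bet_sym bet_outer_trans' m(1) by blast
  have "bet B M Y'" by (rule bet_trans'[OF b(1) Y'(1)])
  then have y: "bet Y M Y'"
    using \<open>B \<noteq> M\<close> bet_sym bet_outer_trans' m(3) by blast
  have lX: "len M X = len M X'" by (rule len_add[OF m(1,2)]) (simp_all only: a b X X')
  have lY: "len M Y = len M Y'" by (rule len_add[OF m(3,4)]) (simp_all only: a b Y Y')
  have lXY: "len M X = len Y M"
    by (rule len_add[OF m(1) bet_sym[OF m(3)]]) (simp_all only: Y(2) X(2) len_commute[of Y B] len_commute[of B M])
  have XM: "X \<noteq> M" using lXY m(1) \<open>A \<noteq> M\<close> bet_identity by blast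
  have e1: "len X Y' = len Y' X" by (rule len_commute)
  have e2: "len X' Y' = len Y X"
    by (rule five_segment_len[OF XM x bet_sym[OF y]])
       (simp_all only: lX[symmetric] lY[symmetric] lXY len_commute[of Y' M] len_commute[of X M] e1 len_commute[of M Y])
  have e3: "len B X = len B' X'"
    by (rule inner_five_segment[OF bet_sym[OF m(3)] bet_sym[OF m(4)]])
       (simp_all only: lX lY b e2 len_commute[of Y M] len_commute[of Y' M] len_commute[of B M] len_commute[of B' M]
         len_commute[of Y' X'])
  have e4: "len A B = len A' B'"
    by (rule inner_five_segment[OF bet_sym[OF m(1)] bet_sym[OF m(2)]])
       (simp_all only: lX a b e3 len_commute[of X M] len_commute[of X' M] len_commute[of A M] len_commute[of A' M]
         len_commute[of X B] len_commute[of X' B'])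
  then show ?thesis by (simp only: A'_def B'_def)
qed

definition isometry where "isometry f \<longleftrightarrow> (\<forall>x y. len (f x) (f y) = len x y)"

lemma isometryD: "isometry f \<Longrightarrow> len (f x) (f y) = len x y"
  by (simp add: isometry_def)

lemma isometry_half_turn: "isometry (half_turn M)"
  by (simp add: isometry_def half_turn_iso)

lemma isometry_id: "isometry (\<lambda>x. x)"
  by (simp add: isometry_def)

lemma isometry_comp: "isometry f \<Longrightarrow> isometry g \<Longrightarrow> isometry (\<lambda>x. f (g x))"
  by (simp add: isometry_def)

lemma isometry_inj: "isometry f \<Longrightarrow> f x = f y \<longleftrightarrow> x = y"
  by (metis isometryD len_eq_null)

lemma isometry_bet: "isometry f \<Longrightarrow> bet x y z \<Longrightarrow> bet (f x) (f y) (f z)"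
  by (rule bet_cong) (simp_all only: isometryD)

lemma isometry_col: "isometry f \<Longrightarrow> collinear x y z \<Longrightarrow> collinear (f x) (f y) (f z)"
  by (rule col_cong) (simp_all only: isometryD)

lemma isometry_col_iff: "isometry f \<Longrightarrow> collinear (f x) (f y) (f z) \<longleftrightarrow> collinear x y z"
  by (rule iffI, erule col_cong[of "f x"]) (simp_all only: isometryD isometry_col)

lemma isometry_commute_half_turn: "isometry f \<Longrightarrow> f (half_turn M x) = half_turn (f M) (f x)"
  by (rule half_turn_eqI[symmetric]) (simp_all only: isometry_bet half_turn_bet isometryD half_turn_len)

text \<open>
  In a plane, if the images of a point under two isometries differ, then every point on which the
  isometries agree has its image on the perpendicular bisector of these two images.
\<close>

lemma isometry_unique:
  assumes "isometry f" "isometry g" "\<not> collinear a b c" "f a = g a" "f b = g b" "f c = g c"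
  shows "f x = g x"
proof (rule ccontr)
  assume n: "f x \<noteq> g x"
  have "len (f y) (f x) = len (f y) (g x)" if "f y = g y" for y
    using that assms(1,2) by (metis isometryD)
  then have "collinear (f a) (f b) (f c)"
    using equidistant_imp_col[OF n] assms(4-6) by blast
  then show False using assms(1,3) by (simp add: isometry_col_iff)
qed

lemma half_turn_center_unique:
  assumes "half_turn M A = half_turn N A" shows "M = N"
proof (cases "half_turn M A = A")
  case True
  then show ?thesis using assms by simp
next
  case False
  define B where "B = half_turn M A"
  define N' where "N' = half_turn M N"
  have sA: "half_turn M B = A" and sB: "half_turn M A = B" "half_turn N A = B"
    by (simp_all add: B_def assms[symmetric])
  have l1: "len N B = len N A" using half_turn_len[of N A] sB(2) by simp
  have AB: "A \<noteq> B" using False B_def by metis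
  have b: "bet A N B" using half_turn_bet[of A N] sB(2) by simp
  have "len A N' = len B N" unfolding N'_def using half_turn_iso[of M B N] sA by simp
  moreover have "len B N' = len A N" unfolding N'_def using half_turn_iso[of M A N] sB(1) by simp
  ultimately have l2: "len A N = len A N'" "len B N = len B N'"
    by (simp_all only: len_flip[OF l1])
  have "collinear A B N" using b bet_sym unfolding collinear_def by blast
  then have "N = N'" using col_point_determined[OF AB] l2 by blast
  then show ?thesis using N'_def by (metis half_turn_fix)
qed

lemma not_col_ex:
  assumes "A \<noteq> B" shows "\<exists>C. \<not> collinear A B C"
proof (rule ccontr)
  assume h: "\<not> ?thesis"
  obtain X Y Z where n: "\<not> collinear X Y Z" using lower_dimension unfolding collinear_def by blast
  then have xy: "X \<noteq> Y" by auto
  have c: "collinear A B X" "collinear A B Y" "collinear A B Z" using h by auto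
  have c2: "collinear A X Y" "collinear A X Z" "collinear A Y Z"
    using col_trans[OF assms] c by auto
  show False
  proof (cases "A = X")
    case True then show False using c2 n by simp
  next
    case False
    then have "collinear X Y Z"
      using col_trans[of X A Y Z] c2 col_swap by auto
    then show False using n by simp
  qed
qed

section \<open>Perpendiculars and midpoints\<close>

text \<open>
  The angle at \<open>M\<close> between \<open>X\<close> and \<open>A\<close> is right, in a form that allows the degenerate cases
  \<open>X = M\<close> and \<open>A = M\<close>.
\<close>

definition perp where "perp X M A \<longleftrightarrow> len X A = len X (half_turn M A)"

lemma perp_sym: "perp X M A \<longleftrightarrow> perp A M X"
proof -
  have "len X (half_turn M A) = len (half_turn M X) A"
    using half_turn_iso[of M X "half_turn M A"] by simp
  then show ?thesis unfolding perp_def by (metis len_commute)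
qed

lemma perp_refl [simp]: "perp X M M" "perp M M X"
  by (simp_all add: perp_def half_turn_len)

lemma perp_self [simp]: "perp X M X \<longleftrightarrow> X = M"
  by (metis perp_def half_turn_fix len_eq_null' perp_refl(1))

lemma perp_col:
  assumes "perp X M A" "A \<noteq> M" "collinear M A B" shows "perp X M B"
proof -
  have "len A X = len A (half_turn M X)" using assms(1) perp_sym perp_def by blast
  moreover have "len M X = len M (half_turn M X)" by (simp add: half_turn_len)
  ultimately have "len B X = len B (half_turn M X)"
    using equidistant_on_line assms(2,3) by metis
  then show ?thesis using perp_sym perp_def by blast
qed

lemma perp_half_turn: "perp X M A \<Longrightarrow> perp X M (half_turn M A)"
  unfolding perp_def by simp

lemma isometry_perp: "isometry f \<Longrightarrow> perp X M A \<Longrightarrow> perp (f X) (f M) (f A)"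
  unfolding perp_def by (simp only: isometry_commute_half_turn[symmetric] isometryD)

text \<open>
  Suppose that \<open>A \<noteq> B\<close>, and let \<open>C\<close> be the image of \<open>B\<close> in the half-turn about \<open>A\<close>.  Both \<open>X\<close>
  and its image \<open>Y\<close> in the half-turn about \<open>B\<close> are equidistant from \<open>B\<close> and \<open>C\<close>; hence so is
  the point \<open>B\<close> of the line \<open>XY\<close>, that is, \<open>B = C\<close>.
\<close>

lemma foot_unique:
  assumes "perp X A B" "perp X B A" shows "A = B"
proof (rule ccontr)
  assume n: "A \<noteq> B"
  define C where "C = half_turn A B"
  define Y where "Y = half_turn B X"
  have XBC: "perp X B C"
    using perp_col[OF assms(2) n] half_turn_col C_def col_swap by blast
  have "len C X = len C Y" using XBC perp_sym perp_def Y_def by blast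
  moreover have "len B X = len B Y" using Y_def half_turn_len by simp
  moreover have "len C X = len B X"
    using assms(1) perp_def C_def len_commute by metis
  moreover have "len A Y = len A X" using assms(2) perp_sym perp_def Y_def by metis
  ultimately have "len Y B = len Y C" "len X B = len X C" using len_commute by metis+
  moreover have "X \<noteq> Y" using assms n Y_def perp_def C_def perp_sym
    by (metis half_turn_fix perp_self)
  ultimately have "len B B = len B C"
    using equidistant_on_line[of X Y B B C] half_turn_col[of X B] Y_def col_rot col_swap by metis
  then show False using C_def n by (metis half_turn_fix len_eq_null')
qed

lemma perp_unique:
  assumes "perp P A B" "perp Q A B" "A \<noteq> B" shows "collinear A P Q"
  by (rule equidistant_imp_col[of B "half_turn A B"])
     (use assms in \<open>simp_all add: perp_def half_turn_len\<close>, metis half_turn_fix)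

lemma col_unique:
  assumes "\<not> collinear a b c" "collinear a b x" "collinear a c x" shows "x = a"
proof (rule ccontr)
  assume "x \<noteq> a"
  then have "collinear a b c" using col_trans[of a x b c] assms(2,3) col_rot col_swap by metis
  then show False using assms(1) by simp
qed

lemma ray_unique:
  assumes "bet C A B" "len C A = len C B" shows "A = B"
proof (cases "A = C")
  case True then show ?thesis using assms by simp
next
  case False
  define E where "E = half_turn C A"
  have 1: "bet E C A" "E \<noteq> C" using E_def half_turn_bet bet_sym False by auto
  have "bet E C B" using bet_outer_trans'[OF 1(1) assms(1)] False by simp
  then show ?thesis using extend_unique[OF 1(2,1)] assms(2) by blast
qed

text \<open>
  Off the line, prolong the legs equally to \<open>P\<close> and \<open>Q\<close>.  The segments \<open>AQ\<close> and \<open>BP\<close> meet in a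
  point \<open>R\<close> of the axis of symmetry, and the line \<open>RC\<close> meets \<open>AB\<close> in the midpoint.
\<close>

lemma isosceles_midpoint:
  assumes "len C A = len C B" shows "\<exists>M. half_turn M A = B"
proof (cases "collinear C A B")
  case True
  show ?thesis
  proof (cases "A = B")
    case True then show ?thesis by (metis half_turn_center)
  next
    case False
    have "A \<noteq> C" using False assms by auto
    have "bet A C B"
    proof -
      consider "bet A C B" | "bet C A B" | "bet C B A" using True bet_sym unfolding collinear_def by blast
      then show ?thesis
      proof cases
        case 2
        then show ?thesis using ray_unique[OF 2 assms] False by simp
      next
        case 3
        then show ?thesis using ray_unique[OF 3 assms[symmetric]] False by simp
      qed
    qed
    then show ?thesis using half_turn_eqI[of A C B] assms by auto
  qed
next
  case False
  have AB: "A \<noteq> B" and AC: "A \<noteq> C" and BC: "B \<noteq> C" using False by auto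
  obtain P where P: "bet C A P" "len A P = len A B" using extend .
  obtain Q where Q: "bet C B Q" "len B Q = len A B" using extend .
  have nP: "A \<noteq> P" "B \<noteq> Q" using P Q AB by auto
  have PQ: "len A P = len B Q" using P Q by simp
  obtain R where R: "bet A R Q" "bet B R P" using inner_pasch[OF bet_sym[OF P(1)] bet_sym[OF Q(1)]] by blast
  have l1: "len P B = len Q A"
    by (rule five_segment_len[OF _ P(1) Q(1) assms PQ])
       (use AC assms len_commute in \<open>auto\<close>)
  obtain R' where R': "bet B R' P" "len A R = len B R'" "len R Q = len R' P"
    using bet_transfer_ex[OF R(1) len_flip[OF l1[symmetric]]] .
  have l2: "len R B = len R' A"
    by (rule inner_five_segment[OF R(1) R'(1)])
       (simp_all only: R' len_flip[OF l1[symmetric]] len_commute[of A B] PQ[symmetric] len_commute[of Q B] len_commute[of P A])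
  have l3: "len R P = len R' Q"
    by (rule inner_five_segment[OF R(1) R'(1)])
       (simp_all only: R' len_flip[OF l1[symmetric]] PQ len_commute[of Q P])
  have "bet A R' Q"
    by (rule bet_cong[OF R(2)]) (simp_all only: len_flip[OF l1] l2[THEN len_flip] l3)
  moreover have "\<not> collinear Q A B"
  proof
    assume "collinear Q A B"
    moreover have "collinear Q B C" using Q(1) unfolding collinear_def using bet_sym by blast
    ultimately have "collinear B A C"
      using col_trans[of B Q A C] nP col_rot col_swap by metis
    then show False using False col_rot col_swap by metis
  qed
  ultimately have "R = R'"
  proof -
    assume b: "bet A R' Q" and n: "\<not> collinear Q A B"
    have BP: "B \<noteq> P" using False P(1) collinear_def by blast
    have AQ: "A \<noteq> Q" using n by auto
    have nc: "\<not> collinear A Q P"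
    proof
      assume "collinear A Q P"
      moreover have "collinear A P C" using P(1) unfolding collinear_def using bet_sym by blast
      ultimately have "collinear A Q C" using col_trans[of A P Q C] nP col_rot col_swap by metis
      moreover have "collinear Q C B" using Q(1) unfolding collinear_def using bet_sym by blast
      moreover have "Q \<noteq> C" using Q BC bet_identity by blast
      ultimately have "collinear Q A B" using col_trans[of Q C A B] col_rot col_swap by metis
      then show False using n by simp
    qed
    show "R = R'"
    proof (rule ccontr)
      assume d: "R \<noteq> R'"
      have c: "collinear A Q R" "collinear A Q R'" "collinear B P R" "collinear B P R'"
        using R R' b unfolding collinear_def using bet_sym by blast+
      then have "collinear R R' Q" "collinear R R' P" "collinear R R' A"
        using d AQ BP by (metis col_trans col_rot col_swap)+
      then have "collinear A Q P" using d by (metis col_trans col_rot col_swap)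
      then show False using nc by simp
    qed
  qed
  then have RAB: "len R A = len R B" using l2 by simp
  obtain X where X: "bet A X B" "bet R X C"
    using inner_pasch[OF P(1) R(2)] by blast
  have "R \<noteq> C"
  proof
    assume "R = C"
    then have "collinear A C Q" using R collinear_def by blast
    moreover have "collinear C Q B" using Q(1) unfolding collinear_def using bet_sym by blast
    moreover have "Q \<noteq> C" using Q BC bet_identity by blast
    ultimately have "collinear C A B" using col_trans[of C Q A B] col_rot col_swap by metis
    then show False using False by simp
  qed
  then have "len X A = len X B"
    using equidistant_on_line[of R C X A B] RAB assms X(2) bet_sym unfolding collinear_def by metis
  then show ?thesis using half_turn_eqI[OF X(1)] by metis
qed


lemma col3:
  assumes "p \<noteq> q" "collinear p q x" "collinear p q y" "collinear p q z"
  shows "collinear x y z"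
proof -
  have c: "collinear p x y" "collinear p x z" "collinear p y z"
    using assms col_trans by blast+
  show ?thesis
  proof (cases "p = x")
    case True then show ?thesis using c by simp
  next
    case False
    then show ?thesis using col_trans[of x p y z] c(1,2) col_swap by blast
  qed
qed

lemma line_eq:
  assumes "p \<noteq> q" "x \<noteq> y" "collinear p q x" "collinear p q y"
  shows "collinear x y z \<longleftrightarrow> collinear p q z"
proof
  assume z: "collinear x y z"
  have "collinear x y p" "collinear x y q" using col3[OF assms(1,3,4)] by auto
  then show "collinear p q z" using col3[OF assms(2)] z by blast
next
  assume "collinear p q z"
  then show "collinear x y z" using col3[OF assms(1,3,4)] by blast
qed

lemma len_half_turn_double:
  assumes "len M A = len N B" shows "len A (half_turn M A) = len B (half_turn N B)"
  by (rule len_add[OF half_turn_bet half_turn_bet])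
     (simp_all only: half_turn_len assms len_flip[OF assms])

text \<open>
  A circle about \<open>X\<close> that has the point \<open>A\<close> of the line in its interior cuts the line in two points
  \<open>Y\<close>, \<open>Z\<close> with \<open>XY = XZ\<close>; the foot of the perpendicular is the midpoint of \<open>YZ\<close>.
\<close>

lemma foot_exists_off_line:
  assumes "\<not> collinear A B X"
  obtains M where "collinear A B M" "perp X M A" "perp X M B"
proof -
  have AB: "A \<noteq> B" and AX: "A \<noteq> X" using assms by auto
  obtain E where E: "bet X A E" "len A E = len A B" using extend .
  have AE: "A \<noteq> E" using E AB by auto
  obtain Y Z where Y: "cong X Y X E" "cong X Z X E" "bet Y A Z"
    "bet A B Y \<or> bet B Y A \<or> bet Y A B" "bet A B Z \<or> bet B Z A \<or> bet Z A B"
    using line_circle_continuity[OF E(1) AE AB] by blast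
  have YZ: "Y \<noteq> Z"
  proof
    assume "Y = Z"
    then have "A = Y" using Y(3) bet_identity by blast
    then have "len X A = len X E" using Y(1) cong_iff_len by simp
    then show False using ray_unique[OF E(1)] AE by simp
  qed
  have "len X Y = len X Z" using Y(1,2) cong_iff_len by simp
  then obtain M where M: "half_turn M Y = Z" using isosceles_midpoint by blast
  have MY: "M \<noteq> Y" using M YZ by auto
  have c: "collinear A B Y" "collinear A B Z" using Y(4,5) by (auto simp: collinear_def)
  then have c2: "collinear A Y Z" using col_trans AB by blast
  have c3: "collinear Y Z M" using half_turn_col[of Y M] M col_rot col_swap by metis
  have cM: "collinear Y Z A" "collinear Y Z B"
  proof -
    show a: "collinear Y Z A" using c2 col_rot by blast
    show "collinear Y Z B"
    proof (cases "A = Y")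
      case True
      then show ?thesis using c(2) col_rot col_swap by metis
    next
      case False
      have "collinear A Y B" using c(1) col_rot col_swap by blast
      then show ?thesis using col_trans[of Y A Z B] False a c2 col_rot col_swap by metis
    qed
  qed
  have cYM: "collinear M Y A" "collinear M Y B"
    using col_trans[OF YZ c3 cM(1)] col_trans[OF YZ c3 cM(2)] col_swap by blast+
  have p: "perp X M Y" unfolding perp_def M using \<open>len X Y = len X Z\<close> .
  have "collinear A B M" using col3[OF YZ cM c3] .
  moreover have "perp X M A" "perp X M B" using perp_col[OF p MY[symmetric]] cYM by auto
  ultimately show ?thesis using that by blast
qed

text \<open>
  In the triangle \<open>A A' C\<close>, the segment from \<open>C\<close> to the opposite side crosses every segment that
  joins the other two sides.
\<close>

lemma cross_segments:
  assumes "bet A B C" "bet A' B' C" "bet A P A'"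
  obtains Q where "bet P Q C" "bet B Q B'"
proof -
  obtain X where X: "bet P X C" "bet B' X A"
    using inner_pasch[OF assms(3) bet_sym[OF assms(2)]] by blast
  obtain Y where Y: "bet B Y B'" "bet X Y C"
    using inner_pasch[OF bet_sym[OF assms(1)] X(2)] by blast
  have "bet P Y C" using bet_trans[OF X(1) Y(2)] .
  then show ?thesis using that Y by blast
qed

text \<open>
  In coordinates with \<open>A\<close> as origin, let \<open>C = (x, y)\<close> with foot \<open>M = (x, 0)\<close>.  The point
  \<open>P = (0, -y)\<close> is the midpoint of \<open>C' = (-x, -y)\<close> and \<open>C'' = (x, -y)\<close>, which have equal
  distance from \<open>A\<close>.
\<close>

lemma perp_exists_across:
  assumes "\<not> collinear A B C"
  obtains P T where "perp P A B" "P \<noteq> A" "collinear A B T" "bet C T P"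
proof -
  have AB: "A \<noteq> B" and AC: "A \<noteq> C" using assms by auto
  obtain M where M: "collinear A B M" "perp C M A" "perp C M B"
    using foot_exists_off_line[OF assms] .
  show ?thesis
  proof (cases "M = A")
    case True
    have "perp (half_turn A C) A B" using M True perp_half_turn perp_sym by blast
    then show ?thesis using that[of "half_turn A C" A] AC half_turn_bet by auto
  next
    case False
    define C' where "C' = half_turn A C"
    define C'' where "C'' = half_turn M C"
    define M' where "M' = half_turn A M"
    define C3 where "C3 = half_turn A C''"
    have MC: "M \<noteq> C" using M assms by auto
    have cM': "collinear A M M'" using half_turn_col[of M A] M'_def col_swap by blast
    have l1: "len A C = len A C''" using M(2) perp_sym perp_def C''_def by blast
    have l2: "len M C = len M C''" by (simp only: C''_def half_turn_len)
    have l3: "len M' C = len M' C''"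
      using equidistant_on_line[OF False[symmetric] cM' l1 l2] .
    have l4: "len A C' = len A C''" using l1 C'_def half_turn_len by simp
    then obtain P where P: "half_turn P C' = C''" using isosceles_midpoint by blast
    have s: "len C' M = len C M'" unfolding C'_def M'_def using half_turn_iso[of A C "half_turn A M"] by simp
    have s': "len C' M' = len C M" unfolding C'_def M'_def using half_turn_iso[of A C M] by simp
    have b: "bet C' P C''" and PC: "len P C'' = len P C'" using half_turn_bet[of C' P] half_turn_len[of P C'] P by auto
    have "len C' M = len C'' M'" using s l3 len_commute by metis
    moreover have "len C'' M = len C' M'" using s' l2 len_commute by metis
    ultimately have "len P M = len P M'"
      using inner_five_segment[OF b bet_sym[OF b] len_commute, of M M'] PC by simp
    then have pM: "perp P A M" unfolding perp_def M'_def .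
    have cAMB: "collinear A M B" using M(1) col_rot col_swap by blast
    have "perp P A B" using perp_col[OF pM False cAMB] .
    moreover have "P \<noteq> A"
    proof
      assume "P = A"
      then have "C'' = C" using P C'_def by auto
      then show False using C''_def MC by auto
    qed
    moreover obtain T where T: "bet P T C" "bet A T M"
    proof -
      have "bet C' A C" "bet C'' M C" unfolding C'_def C''_def using half_turn_bet bet_sym by blast+
      then show ?thesis using cross_segments[OF _ _ b] that by blast
    qed
    moreover have "collinear A B T"
    proof -
      have "collinear A M T" using T(2) unfolding collinear_def using bet_sym by blast
      then show ?thesis using col_trans[OF False[symmetric] cAMB] by blast
    qed
    ultimately show ?thesis using that bet_sym by blast
  qed
qed

text \<open>
  Exchanging \<open>P\<close> with \<open>R\<close> and \<open>P'\<close> with \<open>R'\<close> preserves all distances between the four corners;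
  hence it maps the common point of the diagonals to itself.
\<close>

lemma diagonals_bisect:
  assumes "bet P X R" "bet P' X R'" "len P P' = len R R'" "len P R' = len P' R" "\<not> collinear P R P'"
  shows "len X P = len X R"
proof -
  obtain Y where Y: "bet R Y P" "len P X = len R Y" "len X R = len Y P"
    using bet_transfer_ex[OF assms(1) len_commute] .
  have l1: "len X P' = len Y R'"
    by (rule inner_five_segment[OF assms(1) Y(1) len_commute Y(3) assms(3)])
       (simp only: len_commute[of R P'] assms(4))
  have l2: "len X R' = len Y P'"
    by (rule inner_five_segment[OF assms(1) Y(1) len_commute Y(3)])
       (simp_all only: assms(3,4) len_commute[of R P'] len_commute[of P P'] len_commute[of P' P])
  have b: "bet R' Y P'"
    by (rule bet_cong[OF assms(2)])
       (simp_all only: l1[THEN len_flip] l2 len_commute[of R' P'])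
  have PR: "P \<noteq> R" using assms(5) by auto
  have P'R': "P' \<noteq> R'"
    using assms(2,5) bet_identity
    by (metis assms(1) bet_sym collinear_def)
  have c: "collinear P R X" "collinear P R Y" "collinear P' R' X" "collinear P' R' Y"
    using assms(1,2) Y(1) b unfolding collinear_def using bet_sym by blast+
  have "X = Y"
  proof (rule ccontr)
    assume d: "X \<noteq> Y"
    have "collinear X Y P'" using c(3,4) P'R' d by (metis col_rot col_swap col_trans)
    moreover have "collinear X Y P" "collinear X Y R"
      using c(1,2) PR d by (metis col_rot col_swap col_trans)+
    ultimately have "collinear P R P'" using d by (metis col_rot col_swap col_trans)
    then show False using assms(5) by simp
  qed
  then show ?thesis using Y(3) len_commute by metis
qed

text \<open>
  Equal perpendiculars \<open>AP\<close> and \<open>BR\<close> are erected on different sides of \<open>AB\<close>, and \<open>X\<close> is the point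
  where \<open>PR\<close> crosses \<open>AB\<close>.  Let \<open>P'\<close> be the image of \<open>P\<close> in the half-turn about \<open>A\<close>, and
  prolong \<open>P'X\<close> by \<open>XR\<close> to \<open>R'\<close>.  Since \<open>X\<close>, \<open>B\<close> and the midpoint of \<open>RR'\<close> are equidistant from \<open>R\<close> and
  \<open>R'\<close>, they are collinear, and uniqueness of the foot shows that \<open>R'\<close> is the image of \<open>R\<close> in
  the half-turn about \<open>B\<close>.  So \<open>P P' R R'\<close> has equal opposite sides, \<open>X\<close> bisects its diagonals, and the half-turn about
  \<open>X\<close> maps \<open>A\<close> to \<open>B\<close>.
\<close>

lemma midpoint_aux:
  assumes "A \<noteq> B" "perp P A B" "P \<noteq> A" "perp Q B A" "collinear A B T" "bet P T Q"
    "bet B R Q" "len A P = len B R"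
  shows "\<exists>M. half_turn M A = B"
proof -
  have off: "\<not> collinear A B Y" if "perp Y A B" "Y \<noteq> A" for Y
    using perp_col[of B A Y Y] that perp_sym assms(1)
    by (metis col_rot foot_unique perp_col perp_refl(2) perp_self)
  have nP: "\<not> collinear A B P" using off assms(2,3) .
  have RB: "R \<noteq> B" using assms(3,8) by auto
  have QB: "Q \<noteq> B" using RB assms(7) bet_identity by blast
  have "collinear B Q R" using assms(7) unfolding collinear_def using bet_sym by blast
  then have pR: "perp R B A" using perp_col[of A B Q R] assms(4) QB perp_sym by blast
  have nR: "\<not> collinear A B R"
    using perp_col[of R B A R] pR assms(1) RB col_swap by fastforce
  obtain X where X: "bet T X B" "bet R X P" using inner_pasch[OF assms(6,7)] by blast
  have cX: "collinear A B X"
  proof (cases "T = B")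
    case True then show ?thesis using X(1) bet_identity[of B X] by auto
  next
    case False
    have "collinear B T X" "collinear B T A" using X(1) assms(5) unfolding collinear_def using bet_sym by blast+
    then have "collinear B X A" using col_trans[of B T X A] False by blast
    then show ?thesis using col_rot col_swap by blast
  qed
  have XP: "X \<noteq> P" "X \<noteq> R" using nP nR cX by auto
  have pA: "perp P A X" using perp_col[OF assms(2) assms(1)[symmetric] cX] .
  have cX': "collinear B A X" using cX col_swap by blast
  have pB: "perp R B X" using perp_col[OF pR assms(1) cX'] .
  have XB: "X \<noteq> B"
  proof
    assume "X = B"
    then have "collinear B R P" using X(2) unfolding collinear_def using bet_sym by blast
    then have "perp P B A" using perp_col[of A B R P] pR RB perp_sym by blast
    then show False using foot_unique assms(1,2) by blast
  qed
  define P' where "P' = half_turn A P"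
  have lP: "len Y P = len Y P'" if "perp P A Y" for Y
    using that perp_sym perp_def P'_def by blast
  have bP: "len B P = len B P'" "len X P = len X P'" using lP assms(2) pA by auto
  obtain R' where R': "bet P' X R'" "len X R' = len X R" using extend .
  have b: "bet P X R" using X(2) bet_sym by blast
  have lR: "len R B = len R' B"
    by (rule five_segment_len[OF XP(1)[symmetric] b R'(1)])
       (simp_all only: bP(2)[THEN len_flip] R'(2) bP(1)[THEN len_flip])
  have RR': "R \<noteq> R'"
  proof
    assume "R = R'"
    then have "bet R X P" "bet R X P'" using b R' bet_sym by auto
    then have "P = P'" using extend_unique[OF XP(2)[symmetric]] bP(2) by blast
    then show False using P'_def assms(3) by (metis half_turn_fix)
  qed
  obtain M where M: "half_turn M R = R'" using isosceles_midpoint[of X R R'] R'(2) by auto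
  have "len M R = len M R'" using half_turn_len M by metis
  then have "collinear X B M"
    using equidistant_imp_col[OF RR' _ len_flip[OF lR]] R'(2) by simp
  then have cM: "collinear B X M" using col_swap by blast
  have "perp B M R" unfolding perp_def M using len_flip[OF lR] .
  then have pM: "perp R M B" using perp_sym by blast
  have MB: "M = B"
  proof (rule foot_unique[OF pM])
    show "perp R B M" using perp_col[OF pB XB cM] .
  qed
  then have R'_def: "R' = half_turn B R" using M by simp
  have "len P P' = len R R'" unfolding P'_def R'_def using len_half_turn_double[OF assms(8)] .
  moreover have "len R P' = len R' P"
    by (rule five_segment_len[OF XP(1)[symmetric] b R'(1)])
       (simp_all only: bP(2)[THEN len_flip] R'(2) bP(2) len_commute[of P P'])
  moreover have "\<not> collinear P R P'"
  proof
    assume "collinear P R P'"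
    moreover have "collinear P P' A" using half_turn_col[of P A] P'_def col_rot col_swap by metis
    moreover have "P \<noteq> P'" using P'_def assms(3) by (metis half_turn_fix)
    ultimately have "collinear A P R" using col_trans[of P P' A R] col_rot col_swap by metis
    then have "perp R A B" using perp_col[of B A P R] assms(2,3) perp_sym by blast
    moreover have "perp R B A" using pR .
    ultimately show False using foot_unique assms(1) by blast
  qed
  ultimately have XPR: "len X P = len X R"
    using diagonals_bisect[OF b R'(1)] len_commute by metis
  then have h: "half_turn X P = R" using half_turn_eqI[OF b] by simp
  have h': "half_turn X P' = R'"
    using half_turn_eqI[OF R'(1)] XPR R'(2) bP(2) by simp
  have "half_turn (half_turn X A) R = R'"
    using isometry_commute_half_turn[OF isometry_half_turn, of X A P] h h' P'_def by simp
  then have "half_turn X A = B" using half_turn_center_unique R'_def by metis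
  then show ?thesis by blast
qed

lemma midpoint_exists: "\<exists>M. half_turn M A = B"
proof (cases "A = B")
  case True then show ?thesis by (metis half_turn_center)
next
  case False
  obtain C where "\<not> collinear A B C" using not_col_ex[OF False] by blast
  then obtain P where P: "perp P A B" "P \<noteq> A" using perp_exists_across by metis
  have "\<not> collinear B A P"
    using perp_col[of P A B P] P False col_swap by (metis perp_self)
  then obtain Q T where Q: "perp Q B A" "Q \<noteq> B" "collinear B A T" "bet P T Q"
    using perp_exists_across by metis
  obtain R where R: "bet (half_turn B Q) B R" "len B R = len A P" using extend .
  have "bet (half_turn B Q) B Q" using half_turn_bet bet_sym by blast
  then consider "bet B R Q" | "bet B Q R" using bet_connect[OF _ R(1)] Q(2) by fastforce
  then show ?thesis
  proof cases
    case 1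
    then show ?thesis using midpoint_aux[OF False P Q(1) col_swap[OF Q(3)] Q(4) 1] R by simp
  next
    case 2
    obtain R' where R': "bet A R' P" "len B Q = len A R'" using bet_transfer_ex[OF 2 R(2)] by metis
    have "\<exists>M. half_turn M B = A"
      using midpoint_aux[OF False[symmetric] Q(1,2) P(1) Q(3) bet_sym[OF Q(4)] R'] .
    then show ?thesis by (metis half_turn_half_turn)
  qed
qed


definition mid where "mid A B = (SOME M. half_turn M A = B)"

lemma half_turn_mid [simp]: "half_turn (mid A B) A = B"
  unfolding mid_def using midpoint_exists by (rule someI_ex)

lemma half_turn_mid' [simp]: "half_turn (mid A B) B = A"
  by (metis half_turn_mid half_turn_half_turn)

lemma mid_eqI: "half_turn M A = B \<Longrightarrow> mid A B = M"
  by (rule half_turn_center_unique[of _ A]) simp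

lemma mid_half_turn [simp]: "mid A (half_turn M A) = M"
  by (rule mid_eqI) simp

lemma mid_commute: "mid A B = mid B A"
  by (rule mid_eqI) simp

lemma mid_self [simp]: "mid A A = A"
  by (rule mid_eqI) simp

lemma bet_mid: "bet A (mid A B) B"
  using half_turn_bet[of A "mid A B"] by simp

lemma isometry_mid: "isometry f \<Longrightarrow> f (mid x y) = mid (f x) (f y)"
  by (rule mid_eqI[symmetric]) (simp add: isometry_commute_half_turn[symmetric])

section \<open>Reflections in lines\<close>

definition foot where
  "foot a b x = (SOME M. collinear a b M \<and> (\<forall>y. collinear a b y \<longrightarrow> perp x M y))"

definition mirror where "mirror a b x = half_turn (foot a b x) x"

lemma foot_exists:
  assumes "a \<noteq> b"
  shows "\<exists>M. collinear a b M \<and> (\<forall>y. collinear a b y \<longrightarrow> perp x M y)"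
proof (cases "collinear a b x")
  case True then show ?thesis by auto
next
  case False
  obtain M where M: "collinear a b M" "perp x M a" "perp x M b"
    using foot_exists_off_line[OF False] .
  have "perp x M y" if y: "collinear a b y" for y
  proof -
    have "collinear M a y" "collinear M b y" using col3[OF assms M(1) _ y] by auto
    then show ?thesis using perp_col M(2,3) assms by metis
  qed
  then show ?thesis using M by blast
qed

lemma foot_col: "a \<noteq> b \<Longrightarrow> collinear a b (foot a b x)"
  and foot_perp: "a \<noteq> b \<Longrightarrow> collinear a b y \<Longrightarrow> perp x (foot a b x) y"
  using someI_ex[OF foot_exists] unfolding foot_def[symmetric] by blast+

lemma foot_eqI:
  assumes "a \<noteq> b" "collinear a b M" "collinear a b y" "y \<noteq> M" "perp x M y"
  shows "foot a b x = M"
proof (rule foot_unique)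
  show "perp x (foot a b x) M" using foot_perp assms by blast
  have "collinear M y (foot a b x)" using col3 assms(1-3) foot_col by blast
  then show "perp x M (foot a b x)" using perp_col assms(4,5) by blast
qed

lemma foot_on_line:
  assumes "a \<noteq> b" "collinear a b x" shows "foot a b x = x"
proof -
  have "perp x (foot a b x) x" using foot_perp assms by blast
  then show ?thesis by simp
qed

lemma mirror_on_line: "a \<noteq> b \<Longrightarrow> collinear a b x \<Longrightarrow> mirror a b x = x"
  by (simp add: mirror_def foot_on_line)

lemma mirror_fix:
  assumes "a \<noteq> b" shows "mirror a b x = x \<longleftrightarrow> collinear a b x"
  using mirror_on_line[OF assms] foot_col[OF assms, of x] by (metis mirror_def half_turn_fix)

lemma other_point_on_line:
  assumes "a \<noteq> b" obtains y where "collinear a b y" "y \<noteq> M"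
  using that[of a] that[of b] assms by auto

lemma foot_mirror: assumes "a \<noteq> b" shows "foot a b (mirror a b x) = foot a b x"
proof -
  obtain y where y: "collinear a b y" "y \<noteq> foot a b x" using other_point_on_line[OF assms] .
  have "perp y (foot a b x) (mirror a b x)"
    unfolding mirror_def using perp_half_turn foot_perp[OF assms y(1)] perp_sym by blast
  then show ?thesis using foot_eqI[OF assms foot_col[OF assms] y] perp_sym by blast
qed

lemma mirror_mirror [simp]: "a \<noteq> b \<Longrightarrow> mirror a b (mirror a b x) = x"
  using foot_mirror[of a b x] unfolding mirror_def by simp

lemma mirror_equidistant:
  assumes "a \<noteq> b" "collinear a b y" shows "len y (mirror a b x) = len y x"
  using foot_perp[OF assms, of x] perp_sym unfolding perp_def mirror_def by metis

text \<open>
  Let \<open>Z\<close> be the midpoint of the two feet.  The half-turn about \<open>Z\<close> carries \<open>x\<close> and its mirror image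
  \<open>x'\<close> to points \<open>U, U'\<close> that are mirror images on the perpendicular through the foot of \<open>y\<close>.
  There \<open>Uy = U'y'\<close> holds by a half-turn, and the five-segment axiom transports this along
  \<open>UZx\<close> and \<open>U'Zx'\<close>.
\<close>

lemma isometry_mirror: assumes ab: "a \<noteq> b" shows "isometry (mirror a b)"
  unfolding isometry_def
proof (intro allI)
  fix x y
  define A B where "A = foot a b x" and "B = foot a b y"
  define x' y' where "x' = mirror a b x" and "y' = mirror a b y"
  define Z where "Z = mid A B"
  have c: "collinear a b A" "collinear a b B" unfolding A_def B_def using foot_col[OF ab] by auto
  have ZAB: "collinear A B Z" using bet_mid[of A B] bet_sym unfolding collinear_def Z_def by blast
  have cZ: "collinear a b Z"
  proof (cases "A = B")
    case True then show ?thesis using c by (simp add: Z_def)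
  next
    case False then show ?thesis using line_eq[OF ab False c] ZAB by simp
  qed
  have e: "len z x' = len z x" "len z y' = len z y" if "collinear a b z" for z
    unfolding x'_def y'_def using mirror_equidistant[OF ab that] by auto
  show "len (mirror a b x) (mirror a b y) = len x y"
  proof (cases "x = Z")
    case True
    then have "x' = x" using mirror_on_line[OF ab] cZ x'_def by simp
    then show ?thesis using e(2)[OF cZ] True x'_def y'_def by simp
  next
    case False
    define U U' where "U = half_turn Z x" and "U' = half_turn Z x'"
    have "U' = half_turn B U"
      unfolding U'_def U_def x'_def mirror_def A_def[symmetric]
      using isometry_commute_half_turn[OF isometry_half_turn, of Z A x] by (simp add: Z_def)
    moreover have "y' = half_turn B y" unfolding y'_def mirror_def B_def ..
    ultimately have l1: "len U' y' = len U y" by (simp only: half_turn_iso)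
    have l2: "len Z U = len Z x" "len Z U' = len Z x'" by (simp_all only: U_def U'_def half_turn_len)
    have b: "bet U Z x" "bet U' Z x'" using half_turn_bet bet_sym U_def U'_def by auto
    have "len x y = len x' y'"
    proof (rule five_segment_len[OF _ b])
      show "U \<noteq> Z" using False U_def by simp
    qed (simp_all only: l1 l2 e[OF cZ] len_commute[of U Z] len_commute[of U' Z])
    then show ?thesis using x'_def y'_def by simp
  qed
qed

section \<open>Separation of the plane by a line\<close>

definition opposite where
  "opposite a b x y \<longleftrightarrow> \<not> collinear a b x \<and> \<not> collinear a b y \<and> (\<exists>z. collinear a b z \<and> bet x z y)"

lemma opposite_sym: "opposite a b x y \<longleftrightarrow> opposite a b y x"
  unfolding opposite_def using bet_sym by blast

lemma mirror_off_line: "a \<noteq> b \<Longrightarrow> collinear a b (mirror a b x) \<longleftrightarrow> collinear a b x"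
  by (metis mirror_on_line mirror_mirror)

lemma col_between_on_line:
  assumes "a \<noteq> b" "collinear a b x" "collinear a b y" "bet x z y" shows "collinear a b z"
proof (cases "x = y")
  case True then show ?thesis using assms bet_identity by blast
next
  case False
  have "collinear x y z" using assms(4) bet_sym unfolding collinear_def by blast
  then show ?thesis using line_eq[OF assms(1) False assms(2,3)] by simp
qed

text \<open>
  Let \<open>T\<close> be the midpoint of the two feet.  The half-turn about \<open>T\<close> carries \<open>x\<close> to a point \<open>R\<close> on
  the perpendicular \<open>By\<close>, on the other side of the line.  Either \<open>y\<close> or its mirror image lies on the
  ray \<open>BR\<close>, and the inner Pasch axiom gives a crossing point between it and \<open>x\<close>: applied at \<open>B\<close>
  if that point is nearer to the line than \<open>R\<close>, and at \<open>A\<close> after the same half-turn otherwise.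
\<close>

lemma opposite_or_mirror:
  assumes ab: "a \<noteq> b" and x: "\<not> collinear a b x" and y: "\<not> collinear a b y"
  shows "opposite a b x y \<or> opposite a b x (mirror a b y)"
proof -
  define A B where "A = foot a b x" and "B = foot a b y"
  define T where "T = mid A B"
  define R where "R = half_turn T x"
  have c: "collinear a b A" "collinear a b B" unfolding A_def B_def using foot_col[OF ab] by auto
  have cT: "collinear a b T" unfolding T_def by (rule col_between_on_line[OF ab c bet_mid])
  have sA: "half_turn T A = B" and sB: "half_turn T B = A" by (simp_all add: T_def)
  obtain z where z: "collinear a b z" "z \<noteq> B" using other_point_on_line[OF ab] .
  have cz: "collinear a b (half_turn T z)"
  proof (cases "z = T")
    case True then show ?thesis using z by simp
  next
    case False
    have "collinear z T (half_turn T z)" by (rule half_turn_col)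
    then show ?thesis using line_eq[OF ab False z(1) cT] by simp
  qed
  have "perp x A (half_turn T z)" unfolding A_def by (rule foot_perp[OF ab cz])
  then have "perp R B z" unfolding R_def
    using isometry_perp[OF isometry_half_turn, of x A "half_turn T z" T] sA by simp
  moreover have "perp y B z" unfolding B_def by (rule foot_perp[OF ab z(1)])
  ultimately have cBR: "collinear B y R" using perp_unique z(2) by metis
  have key: "opposite a b x w" if w: "\<not> collinear a b w" "bet B w R \<or> bet B R w" for w
  proof -
    have xTR: "bet x T R" unfolding R_def by (rule half_turn_bet)
    have "\<exists>Z. collinear a b Z \<and> bet x Z w"
    proof (cases "bet B w R")
      case True
      obtain Z where "bet T Z B" "bet w Z x" using inner_pasch[OF xTR True] by blast
      then show ?thesis using col_between_on_line[OF ab cT c(2)] bet_sym by blast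
    next
      case False
      then have b: "bet B R w" using w by simp
      have "bet A x (half_turn T w)"
        using isometry_bet[OF isometry_half_turn b, of T] sB by (simp add: R_def)
      then obtain Z where "bet T Z A" "bet x Z w" using inner_pasch[OF half_turn_bet] by blast
      then show ?thesis using col_between_on_line[OF ab cT c(1)] by blast
    qed
    then show ?thesis using w(1) x unfolding opposite_def by blast
  qed
  define y' where "y' = mirror a b y"
  have y': "\<not> collinear a b y'" using y mirror_off_line[OF ab] y'_def by simp
  have yy': "bet y B y'" unfolding y'_def mirror_def B_def by (rule half_turn_bet)
  have yB: "y \<noteq> B" using y c(2) by auto
  consider "bet B y R \<or> bet B R y" | "bet y B R" using cBR bet_sym unfolding collinear_def by blast
  then show ?thesis
  proof cases
    case 1 then show ?thesis using key y by blast
  next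
    case 2
    then have "bet B y' R \<or> bet B R y'" using bet_connect[OF yB yy'] by blast
    then show ?thesis using key y' y'_def by blast
  qed
qed

text \<open>
  Two applications of the inner Pasch axiom produce a point \<open>Z\<close> of the segment \<open>EC\<close> that also lies
  on the segment \<open>FB\<close>.  Hence \<open>Z = B\<close>, although \<open>B\<close> is not between \<open>E\<close> and \<open>C\<close>.
\<close>

lemma no_line_meets_all_sides_aux:
  assumes "\<not> collinear A B C" "bet A D B" "bet A F C" "bet B E C" "bet D E F"
    "E \<noteq> B" "F \<noteq> C" "E \<noteq> C"
  shows False
proof -
  obtain X where X: "bet D X C" "bet F X B"
    using inner_pasch[OF bet_sym[OF assms(2)] bet_sym[OF assms(3)]] bet_sym
    by blast
  obtain Z where Z: "bet E Z C" "bet X Z F"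
    using inner_pasch[OF bet_sym[OF assms(5)] bet_sym[OF X(1)]] by blast
  have BC: "B \<noteq> C" using assms(1) by auto
  have "bet F Z B" using bet_trans'[OF bet_sym[OF Z(2)] X(2)] .
  then have c1: "collinear B F Z" using bet_sym unfolding collinear_def by blast
  have "bet B Z C" using bet_trans[OF assms(4) Z(1)] .
  then have c2: "collinear B C Z" using bet_sym unfolding collinear_def by blast
  have "\<not> collinear B C F"
  proof
    assume "collinear B C F"
    moreover have "collinear F C A" using assms(3) bet_sym unfolding collinear_def by blast
    ultimately have "collinear A B C"
      using line_eq[OF BC assms(7), of A] by (metis col_refl(2) col_rot)
    then show False using assms(1) by simp
  qed
  then have "Z = B" using col_unique c1 c2 by blast
  then show False using Z(1) assms(4,6) bet_antisym by blast
qed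

lemma no_line_meets_all_sides:
  assumes ab: "a \<noteq> b" and o: "opposite a b A B" "opposite a b B C" "opposite a b A C"
  shows False
proof -
  have off: "\<not> collinear a b A" "\<not> collinear a b B" "\<not> collinear a b C"
    using o unfolding opposite_def by auto
  obtain D E F where l: "collinear a b D" "collinear a b E" "collinear a b F"
    and s: "bet A D B" "bet B E C" "bet A F C" using o unfolding opposite_def by blast
  have ne: "D \<noteq> A" "D \<noteq> B" "D \<noteq> C" "E \<noteq> A" "E \<noteq> B" "E \<noteq> C" "F \<noteq> A" "F \<noteq> B" "F \<noteq> C"
    using l off by auto
  show False
  proof (cases "collinear A B C")
    case False
    have "collinear D E F" using col3[OF ab l] .
    then consider "bet D E F" | "bet E F D" | "bet F D E" unfolding collinear_def by blast
    then show False
    proof cases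
      case 1
      show False by (rule no_line_meets_all_sides_aux[OF False s(1,3,2) 1 ne(5,9,6)])
    next
      case 2
      have "\<not> collinear B A C" using False col_swap by blast
      then show False
        by (rule no_line_meets_all_sides_aux[OF _ bet_sym[OF s(1)] s(2,3) bet_sym[OF 2] ne(7,6,9)])
    next
      case 3
      have "\<not> collinear C A B" using False col_rot by blast
      then show False
        by (rule no_line_meets_all_sides_aux[OF _ bet_sym[OF s(3)] bet_sym[OF s(2)] s(1) 3 ne(1,5,2)])
    qed
  next
    case True
    have AB: "A \<noteq> B" using s(1) ne bet_identity by blast
    have BC: "B \<noteq> C" using s(2) ne bet_identity by blast
    have AC: "A \<noteq> C" using s(3) ne bet_identity by blast
    have c: "collinear A B D" "collinear A B E" "collinear A B F"
    proof -
      show "collinear A B D" using s(1) bet_sym unfolding collinear_def by blast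
      have "collinear B C E" using s(2) bet_sym unfolding collinear_def by blast
      then show "collinear A B E" using line_eq[OF AB BC _ True] by simp
      have "collinear A C F" using s(3) bet_sym unfolding collinear_def by blast
      then show "collinear A B F" using line_eq[OF AB AC _ True] by simp
    qed
    have same: "P = Q" if "collinear A B P" "collinear A B Q" "collinear a b P" "collinear a b Q" for P Q
    proof (rule ccontr)
      assume d: "P \<noteq> Q"
      have "collinear a b A"
        using line_eq[OF AB d that(1,2), of A] line_eq[OF ab d that(3,4), of A] by simp
      then show False using off by simp
    qed
    have "D = E" "D = F" using same c l by auto
    then have b: "bet A D B" "bet A D C" "bet B D C" using s by auto
    have "bet D B C \<or> bet D C B" using bet_connect[OF _ b(1,2)] ne by blast
    then show False using b(3) ne bet_antisym bet_sym by blast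
  qed
qed

text \<open>
  If \<open>y\<close> were on the side of both \<open>x\<close> and \<open>z\<close>, its mirror image would be opposite to both, and the
  line would meet all three sides of a triangle.
\<close>

lemma pasch:
  assumes "a \<noteq> b" "opposite a b x z" "\<not> collinear a b y"
  shows "opposite a b x y \<or> opposite a b y z"
proof (rule ccontr)
  assume n: "\<not> ?thesis"
  have off: "\<not> collinear a b x" "\<not> collinear a b z" using assms(2) unfolding opposite_def by auto
  have "opposite a b x (mirror a b y)"
    using opposite_or_mirror[OF assms(1) off(1) assms(3)] n by blast
  moreover have "opposite a b z (mirror a b y)"
    using opposite_or_mirror[OF assms(1) off(2) assms(3)] n opposite_sym by blast
  ultimately show False
    using no_line_meets_all_sides[OF assms(1), of x z "mirror a b y"] assms(2) opposite_sym by blast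
qed

section \<open>Uniqueness of parallels\<close>

text \<open>
  A line \<open>mn\<close> that misses the lines \<open>ab\<close> and \<open>ac\<close> has all points of these lines on one side.  If
  \<open>m\<close> is beyond \<open>D\<close>, the parallel axiom yields points of the two lines on opposite sides of \<open>mn\<close>;
  if \<open>m\<close> is before \<open>D\<close>, then \<open>mn\<close> separates \<open>a\<close> from \<open>D\<close>, hence also \<open>b\<close> from \<open>D\<close>, and so it
  meets the segment \<open>bc\<close>.
\<close>

lemma playfair_aux:
  assumes mn: "m \<noteq> n" and off: "\<And>x. collinear m n x \<Longrightarrow> \<not> collinear a b x \<and> \<not> collinear a c x"
    and D: "bet b D c" "bet a D m \<or> bet a m D" "a \<noteq> D" and nc: "\<not> collinear a b c"
  shows False
proof -
  have ab: "a \<noteq> b" "a \<noteq> c" using nc by auto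
  have offa: "\<not> collinear m n a" using off[of a] by auto
  have offp: "\<not> opposite m n a x" if "collinear a b x \<or> collinear a c x" for x
  proof
    assume "opposite m n a x"
    then obtain z where z: "collinear m n z" "bet a z x" unfolding opposite_def by blast
    then have "collinear a b z \<or> collinear a c z"
      using that col_between_on_line[OF ab(1) _ _ z(2)] col_between_on_line[OF ab(2) _ _ z(2)] by auto
    then show False using off z by blast
  qed
  have offxy: "\<not> opposite m n x y" if "collinear a b x" "collinear a c y" for x y
    using pasch[OF mn _ offa, of x y] offp that opposite_sym by blast
  show False
  proof (cases "bet a D m")
    case True
    obtain X Y where XY: "bet a b X" "bet a c Y" "bet X m Y"
      using parallel_axiom[OF True D(1,3)] by blast
    then have c: "collinear a b X" "collinear a c Y" unfolding collinear_def by auto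
    have "opposite m n X Y" unfolding opposite_def using off c XY(3) col_refl(3) by blast
    then show False using offxy c by blast
  next
    case False
    then have b: "bet a m D" using D by simp
    have mD: "m \<noteq> D" using False by auto
    have offD: "\<not> collinear m n D"
    proof
      assume "collinear m n D"
      moreover have "collinear m D a" using b bet_sym unfolding collinear_def by blast
      ultimately show False using line_eq[OF mn mD] offa by simp
    qed
    have "opposite m n a D" unfolding opposite_def using offa offD b col_refl(3) by blast
    moreover have offb: "\<not> collinear m n b" "\<not> collinear m n c" using off col_refl(2) by blast+
    moreover have "\<not> opposite m n a b" using offp by simp
    ultimately have "opposite m n b D" using pasch[OF mn] by blast
    then obtain z where z: "collinear m n z" "bet b z D" unfolding opposite_def by blast
    have "bet b z c" using bet_trans'[OF z(2) D(1)] .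
    then have "opposite m n b c" unfolding opposite_def using z(1) offb by auto
    then show False using offxy by simp
  qed
qed

text \<open>
  The lines \<open>ab\<close> and \<open>ac\<close> divide the plane into four angles; one of them contains \<open>m\<close>.  Replacing
  \<open>c\<close>, or both \<open>b\<close> and \<open>c\<close>, by their images under the half-turn about \<open>a\<close> makes it the angle
  \<open>bac\<close>.
\<close>

lemma playfair:
  assumes mn: "m \<noteq> n" and ab: "a \<noteq> b" "a \<noteq> c"
    and off: "\<And>x. collinear m n x \<Longrightarrow> \<not> collinear a b x \<and> \<not> collinear a c x"
  shows "collinear a b c"
proof (rule ccontr)
  assume nc: "\<not> collinear a b c"
  have am: "a \<noteq> m" using off[of m] by auto
  have nm: "\<not> collinear a b m" "\<not> collinear a c m" using off[of m] by auto
  have offm: "\<not> collinear a m b" "\<not> collinear a m c" using nm col_rot col_swap by blast+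
  define c' where "c' = half_turn a c"
  have cc': "collinear a c c'" using half_turn_col[of c a] c'_def col_swap by blast
  have c'a: "c' \<noteq> a" using c'_def ab by simp
  have linec': "collinear a c' x \<longleftrightarrow> collinear a c x" for x
    using line_eq[OF ab(2) c'a[symmetric] _ cc'] by simp
  have offc': "\<not> collinear a m c'" using nm(2) linec' col_rot col_swap by blast
  have "bet c a c'" unfolding c'_def by (rule half_turn_bet)
  then have "opposite a m c c'" unfolding opposite_def using offm offc' col_refl(3) by blast
  then have "opposite a m c b \<or> opposite a m b c'" using pasch[OF am _ offm(1)] by blast
  then obtain d where d: "opposite a m b d" "\<And>x. collinear a d x \<longleftrightarrow> collinear a c x"
    using opposite_sym linec' by blast
  then obtain D where D: "collinear a m D" "bet b D d" unfolding opposite_def by blast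
  have nd: "\<not> collinear a b d"
  proof
    assume "collinear a b d"
    then have "collinear a d b" using col_rot col_swap by blast
    then have "collinear a c b" using d(2) by simp
    then show False using nc col_rot col_swap by blast
  qed
  have aD: "a \<noteq> D" using D(2) nd unfolding collinear_def using bet_sym by blast
  consider "bet a D m \<or> bet a m D" | "bet D a m" using D(1) bet_sym unfolding collinear_def by blast
  then show False
  proof cases
    case 1
    show False by (rule playfair_aux[OF mn _ D(2) 1 aD nd]) (use off d(2) in auto)
  next
    case 2
    have line: "collinear a (half_turn a x) z \<longleftrightarrow> collinear a x z" if "a \<noteq> x" for x z
    proof -
      have "collinear a x (half_turn a x)" using half_turn_col col_swap by blast
      moreover have "a \<noteq> half_turn a x" using that by (metis half_turn_eq_center)
      ultimately show ?thesis using line_eq[OF that, of a "half_turn a x"] by simp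
    qed
    have ad: "a \<noteq> d" using nd by auto
    have b1: "bet (half_turn a b) (half_turn a D) (half_turn a d)"
      using isometry_bet[OF isometry_half_turn D(2)] .
    have "bet D a (half_turn a D)" by (rule half_turn_bet)
    then have b2: "bet a (half_turn a D) m \<or> bet a m (half_turn a D)"
      using bet_connect[of D a] 2 aD by blast
    have aD': "a \<noteq> half_turn a D" using aD by (metis half_turn_eq_center)
    have "\<not> collinear a b (half_turn a d)"
      using nd line[OF ad] col_rot col_swap by blast
    then have nd': "\<not> collinear a (half_turn a b) (half_turn a d)" using line[OF ab(1)] by simp
    show False by (rule playfair_aux[OF mn _ b1 b2 aD' nd']) (use off d(2) line ab ad in auto)
  qed
qed


text \<open>
  A line counts as parallel to itself.  The notion is meaningful for \<open>a \<noteq> b\<close> and \<open>c \<noteq> d\<close>.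
\<close>

definition parallel where
  "parallel a b c d \<longleftrightarrow> (\<forall>x. collinear a b x \<longrightarrow> \<not> collinear c d x) \<or> (\<forall>x. collinear a b x \<longleftrightarrow> collinear c d x)"

lemma parallel_trans:
  assumes ne: "a \<noteq> b" "c \<noteq> d" "e \<noteq> f" and p: "parallel a b c d" "parallel c d e f"
  shows "parallel a b e f"
proof -
  consider "\<forall>x. collinear a b x \<longleftrightarrow> collinear c d x" | "\<forall>x. collinear c d x \<longleftrightarrow> collinear e f x"
    | "\<forall>x. collinear a b x \<longrightarrow> \<not> collinear c d x" "\<forall>x. collinear c d x \<longrightarrow> \<not> collinear e f x"
    using p unfolding parallel_def by blast
  then show ?thesis
  proof cases
    case 1 then show ?thesis using p(2) unfolding parallel_def by simp
  next
    case 2 then show ?thesis using p(1) unfolding parallel_def by simp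
  next
    case 3
    show ?thesis
    proof (cases "\<exists>z. collinear a b z \<and> collinear e f z")
      case False then show ?thesis unfolding parallel_def by blast
    next
      case True
      then obtain z where z: "collinear a b z" "collinear e f z" by blast
      obtain p where p: "collinear a b p" "p \<noteq> z" using other_point_on_line[OF ne(1)] .
      obtain q where q: "collinear e f q" "q \<noteq> z" using other_point_on_line[OF ne(3)] .
      have l: "collinear z p x \<longleftrightarrow> collinear a b x" "collinear z q x \<longleftrightarrow> collinear e f x" for x
        using line_eq[OF ne(1) p(2)[symmetric] z(1) p(1)] line_eq[OF ne(3) q(2)[symmetric] z(2) q(1)] by auto
      have c: "collinear z p q"
        by (rule playfair[OF ne(2) p(2)[symmetric] q(2)[symmetric]]) (use 3 l in blast)
      then have "collinear z p x \<longleftrightarrow> collinear z q x" for x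
        using line_eq[OF p(2)[symmetric] q(2)[symmetric] _ c] by simp
      then show ?thesis using l unfolding parallel_def by simp
    qed
  qed
qed

lemma half_turn_on_line:
  assumes "a \<noteq> b" "collinear a b m" "collinear a b x" shows "collinear a b (half_turn m x)"
proof (cases "x = m")
  case True then show ?thesis using assms by simp
next
  case False
  show ?thesis using line_eq[OF assms(1) False assms(3,2)] half_turn_col by blast
qed

lemma half_turn_parallel:
  assumes ab: "a \<noteq> b" shows "parallel a b (half_turn m a) (half_turn m b)"
proof -
  let ?a = "half_turn m a" and ?b = "half_turn m b"
  have ab': "?a \<noteq> ?b" using ab isometry_inj[OF isometry_half_turn] by blast
  show ?thesis
  proof (cases "collinear a b m")
    case True
    have "collinear a b ?a" "collinear a b ?b" using half_turn_on_line[OF ab True] by auto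
    then have "collinear ?a ?b x \<longleftrightarrow> collinear a b x" for x using line_eq[OF ab ab'] by blast
    then show ?thesis unfolding parallel_def by simp
  next
    case False
    have "\<not> collinear ?a ?b z" if z: "collinear a b z" for z
    proof
      assume z': "collinear ?a ?b z"
      have "collinear a b (half_turn m z)"
        using isometry_col[OF isometry_half_turn z', of m] by simp
      moreover have "half_turn m z \<noteq> z" using z False by auto
      moreover have "collinear z (half_turn m z) m" using half_turn_col col_rot col_swap by blast
      ultimately have "collinear a b m" using line_eq[OF ab _ z, of "half_turn m z" m] by metis
      then show False using False by simp
    qed
    then show ?thesis unfolding parallel_def by blast
  qed
qed

lemma on_line_equidistant:
  assumes "collinear c x y" "len c x = len c y" shows "y = x \<or> y = half_turn c x"
proof -
  consider "bet x c y" | "bet c x y" | "bet c y x" using assms(1) bet_sym unfolding collinear_def by blast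
  then show ?thesis
  proof cases
    case 1 then show ?thesis using half_turn_eqI[OF 1] assms(2) by simp
  next
    case 2 then show ?thesis using ray_unique[OF 2 assms(2)] by simp
  next
    case 3 then show ?thesis using ray_unique[OF 3 assms(2)[symmetric]] by simp
  qed
qed

text \<open>
  Such an isometry maps each line through \<open>c\<close> to itself, so it sends every point \<open>x\<close> to \<open>x\<close> or to
  its image under the half-turn about \<open>c\<close>.  The choice is the same for points \<open>p, q\<close> not collinear
  with \<open>c\<close>, because the midpoint of \<open>pq\<close> must be treated in one of the two ways as well.
\<close>

lemma isometry_preserving_directions:
  assumes g: "isometry g" "g c = c" and p: "\<And>x y. x \<noteq> y \<Longrightarrow> parallel x y (g x) (g y)"
  shows "g = (\<lambda>x. x) \<or> g = half_turn c"
proof -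
  have pm: "g x = x \<or> g x = half_turn c x" for x
  proof (cases "x = c")
    case True then show ?thesis using g by simp
  next
    case False
    have "parallel c x c (g x)" using p[of c x] False g(2) by simp
    then have "collinear c x (g x)" unfolding parallel_def using col_refl(2,3) by blast
    moreover have "len c x = len c (g x)" using isometryD[OF g(1), of c x] g(2) by simp
    ultimately show ?thesis using on_line_equidistant by blast
  qed
  obtain p where pc: "p \<noteq> c" using lower_dimension by (metis bet_refl_left)
  obtain q where n: "\<not> collinear c p q" using not_col_ex[of c p] pc by blast
  then have n': "\<not> collinear c q p" using col_rot col_swap by blast
  have key: False if n: "\<not> collinear c p q" and gp: "g p = p" and gq: "g q = half_turn c q" for p q
  proof -
    have r: "g (mid p q) = mid p (half_turn c q)" using isometry_mid[OF g(1)] gp gq by simp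
    have ne: "p \<noteq> c" "q \<noteq> c" using n by auto
    from pm[of "mid p q"] show False
    proof
      assume "g (mid p q) = mid p q"
      then have "half_turn (mid p q) p = half_turn c q" using r half_turn_mid by metis
      then have "q = half_turn c q" by simp
      then show False using ne by (metis half_turn_fix)
    next
      assume "g (mid p q) = half_turn c (mid p q)"
      also have "\<dots> = mid (half_turn c p) (half_turn c q)" by (rule isometry_mid[OF isometry_half_turn])
      finally have "half_turn (mid p (half_turn c q)) (half_turn c q) = half_turn c p" using r by simp
      then have "p = half_turn c p" by simp
      then show False using ne by (metis half_turn_fix)
    qed
  qed
  have "g p = p \<and> g q = q \<or> g p = half_turn c p \<and> g q = half_turn c q"
    using pm[of p] pm[of q] key[OF n] key[OF n'] by blast
  then show ?thesis
  proof
    assume "g p = p \<and> g q = q"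
    then have "g x = x" for x
      using isometry_unique[OF g(1) isometry_id n] g(2) by simp
    then show ?thesis by auto
  next
    assume "g p = half_turn c p \<and> g q = half_turn c q"
    then have "g x = half_turn c x" for x
      using isometry_unique[OF g(1) isometry_half_turn n] g(2) by simp
    then show ?thesis by auto
  qed
qed

text \<open>
  Let \<open>f\<close> be the product on the left, and let \<open>d\<close> be the midpoint of \<open>c\<close> and \<open>f c\<close>.  The half-turn
  about \<open>d\<close> after \<open>f\<close> fixes \<open>c\<close> and, as every half-turn maps lines to parallel lines, preserves
  directions.  So it is the identity, as desired, or the half-turn about \<open>c\<close>.  The latter is
  impossible: \<open>c\<close> cancels, the product of the half-turns about \<open>a\<close> and \<open>b\<close> becomes the
  half-turn about \<open>d\<close>, and its fixed point \<open>d\<close> forces \<open>a = b\<close>.  Testing at the point \<open>c\<close>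
  itself spares an argument about orientation on lines.
\<close>

lemma three_half_turns: "\<exists>d. \<forall>x. half_turn a (half_turn b (half_turn c x)) = half_turn d x"
proof -
  define d where "d = mid c (half_turn a (half_turn b c))"
  define g where "g x = half_turn d (half_turn a (half_turn b (half_turn c x)))" for x
  have inj: "half_turn m x \<noteq> half_turn m y" if "x \<noteq> y" for m x y
    using that isometry_inj[OF isometry_half_turn] by blast
  have "isometry g" unfolding g_def isometry_def by (simp add: half_turn_iso)
  moreover have "g c = c" unfolding g_def d_def by simp
  moreover have "parallel x y (g x) (g y)" if "x \<noteq> y" for x y
  proof -
    have step: "parallel x y (half_turn m u) (half_turn m v)" if "parallel x y u v" "u \<noteq> v" for m u v
      using parallel_trans[OF \<open>x \<noteq> y\<close> that(2) inj[OF that(2)] that(1) half_turn_parallel[OF that(2)]] .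
    have "parallel x y x y" unfolding parallel_def by simp
    then show ?thesis unfolding g_def using step inj \<open>x \<noteq> y\<close> by simp
  qed
  ultimately consider "g = (\<lambda>x. x)" | "g = half_turn c" using isometry_preserving_directions by blast
  then show ?thesis
  proof cases
    case 1
    have "half_turn a (half_turn b (half_turn c x)) = half_turn d x" for x
      using fun_cong[OF 1, of x] unfolding g_def by (metis half_turn_half_turn)
    then show ?thesis by blast
  next
    case 2
    have *: "half_turn d (half_turn a (half_turn b y)) = y" for y
      using fun_cong[OF 2, of "half_turn c y"] unfolding g_def by simp
    then have "half_turn a (half_turn b d) = d" by (metis half_turn_center half_turn_half_turn)
    then have "half_turn b d = half_turn a d" by (metis half_turn_half_turn)
    then have "a = b" using half_turn_center_unique by blast
    then have "half_turn d y = y" for y using * by simp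
    then have "y = d" for y by simp
    then show ?thesis by metis
  qed
qed

end

section \<open>Vectors\<close>

locale pointed_plane = euclidean_plane bet cong
  for bet :: "'p \<Rightarrow> 'p \<Rightarrow> 'p \<Rightarrow> bool" and cong +
  fixes origin :: 'p
begin

text \<open>
  The fourth corner of the parallelogram on \<open>x\<close> and \<open>y\<close>.  The definition by a midpoint makes
  commutativity and invariance under isometries immediate; it also covers the collinear case.
\<close>

definition vadd where "vadd x y = half_turn (mid x y) origin"
definition vneg where "vneg x = half_turn origin x"
definition vsub where "vsub x y = vadd x (vneg y)"

text \<open>
  The product of the half-turns about the midpoint of the origin and \<open>x\<close>, the origin, and the midpoint
  of the origin and \<open>y\<close> is the half-turn about the midpoint of \<open>x\<close> and \<open>y\<close>.
\<close>

lemma vadd_translation: "vadd x y = half_turn (mid origin x) (half_turn origin y)"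
proof -
  obtain d where d: "\<And>z. half_turn (mid origin x) (half_turn origin (half_turn (mid origin y) z)) = half_turn d z"
    using three_half_turns by metis
  have "half_turn d y = x" using d[of y] by simp
  then have "mid x y = d" by (metis mid_eqI mid_commute)
  then show ?thesis using d[of origin] by (simp add: vadd_def)
qed

lemma vadd_commute: "vadd x y = vadd y x"
  by (simp add: vadd_def mid_commute)

lemma vadd_assoc: "vadd (vadd x y) z = vadd x (vadd y z)"
proof -
  obtain d where d: "\<And>z. half_turn (mid origin x) (half_turn origin (half_turn (mid origin y) z)) = half_turn d z"
    using three_half_turns by metis
  have "half_turn d origin = vadd x y" using d[of origin] by (simp add: vadd_translation)
  then have "mid origin (vadd x y) = d" by (metis mid_eqI)
  then show ?thesis using d[of "half_turn origin z"] by (simp add: vadd_translation)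
qed

lemma vadd_origin [simp]: "vadd origin x = x" "vadd x origin = x"
  by (simp_all add: vadd_def)

lemma vadd_vneg [simp]: "vadd (vneg x) x = origin"
  unfolding vadd_def vneg_def by (simp add: mid_commute)

sublocale V: ab_group_add vadd origin vsub vneg
proof
  show "vadd (vadd x y) z = vadd x (vadd y z)" for x y z by (rule vadd_assoc)
  show "vadd x y = vadd y x" for x y by (rule vadd_commute)
  show "vadd origin x = x" for x by simp
  show "vadd (vneg x) x = origin" for x by simp
  show "vsub x y = vadd x (vneg y)" for x y by (rule vsub_def)
qed

lemma isometry_vadd: "isometry (vadd x)"
  unfolding isometry_def vadd_translation by (simp add: half_turn_iso)

definition half where "half x = mid origin x"

lemma half_double: "vadd (half x) (half x) = x"
  by (simp add: vadd_def half_def)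

lemma double_eq: "vadd x x = vadd y y \<Longrightarrow> x = y"
  unfolding vadd_def using half_turn_center_unique by simp

lemma double_half: "half (vadd x x) = x"
  by (rule double_eq) (simp add: half_double)

lemma half_add: "half (vadd x y) = vadd (half x) (half y)"
proof (rule double_eq)
  have "vadd (vadd (half x) (half y)) (vadd (half x) (half y)) = vadd (vadd (half x) (half x)) (vadd (half y) (half y))"
    by (simp only: V.add.assoc V.add.left_commute)
  then show "vadd (half (vadd x y)) (half (vadd x y)) = vadd (vadd (half x) (half y)) (vadd (half x) (half y))"
    by (simp only: half_double)
qed

lemma len_vec: "len x y = len origin (vsub y x)"
  using isometryD[OF isometry_vadd, of x origin "vsub y x"] vadd_commute[of x "vsub y x"] by simp

lemma half_eq_origin [simp]: "half x = origin \<longleftrightarrow> x = origin"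
  by (metis V.add_0_left half_double double_half)


lemma vneg_vneg [simp]: "vneg (vneg x) = x"
  by (simp add: vneg_def)

section \<open>Rotations and reflections about the origin\<close>

definition linear where "linear f \<longleftrightarrow> isometry f \<and> f origin = origin"

lemma linear_add: "linear f \<Longrightarrow> f (vadd x y) = vadd (f x) (f y)"
  unfolding vadd_def linear_def by (simp add: isometry_commute_half_turn isometry_mid)

lemma linear_neg: "linear f \<Longrightarrow> f (vneg x) = vneg (f x)"
  unfolding vneg_def linear_def by (simp add: isometry_commute_half_turn)

lemma linear_sub: "linear f \<Longrightarrow> f (vsub x y) = vsub (f x) (f y)"
  by (simp only: vsub_def linear_add linear_neg)

lemma linear_half: "linear f \<Longrightarrow> f (half x) = half (f x)"
  unfolding half_def linear_def by (simp add: isometry_mid)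

lemma linear_origin: "linear f \<Longrightarrow> f origin = origin"
  by (simp add: linear_def)

lemma linear_len: "linear f \<Longrightarrow> len origin (f x) = len origin x"
  unfolding linear_def by (metis isometryD)

lemma linear_comp: "linear f \<Longrightarrow> linear g \<Longrightarrow> linear (\<lambda>x. f (g x))"
  by (simp add: linear_def isometry_comp)

lemma linear_mirror: "u \<noteq> origin \<Longrightarrow> linear (mirror origin u)"
  by (simp add: linear_def isometry_mirror mirror_on_line)

lemma linear_vneg: "linear vneg"
  unfolding linear_def vneg_def by (simp add: isometry_half_turn)

lemma vneg_origin [simp]: "vneg origin = origin"
  by (simp add: vneg_def)

lemma vneg_fix [simp]: "vneg x = x \<longleftrightarrow> x = origin"
  by (simp add: vneg_def)

lemma vneg_eq_origin [simp]: "vneg x = origin \<longleftrightarrow> x = origin"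
  by (simp add: vneg_def)

lemma mirror_mid:
  assumes "len origin v = len origin w" "mid v w \<noteq> origin"
  shows "mirror origin (mid v w) v = w"
proof -
  have "perp origin (mid v w) v" unfolding perp_def using assms(1) by simp
  then have "foot origin (mid v w) v = mid v w"
    using foot_eqI[of origin "mid v w" "mid v w" origin v] assms(2) perp_sym by auto
  then show ?thesis by (simp add: mirror_def)
qed

lemma mirror_perp:
  assumes "perp x origin u" "u \<noteq> origin" shows "mirror origin u x = vneg x"
  using foot_eqI[of origin u origin u x] assms by (simp add: mirror_def vneg_def)

lemma perp_not_col:
  assumes "perp y origin x" "x \<noteq> origin" "y \<noteq> origin" shows "\<not> collinear origin x y"
proof
  assume "collinear origin x y"
  then have "perp y origin y" using perp_col[OF assms(1,2)] by blast
  then show False using assms(3) by simp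
qed

text \<open>
  The product of the reflection in a line \<open>origin e\<close> and the reflection that exchanges \<open>e\<close> with an
  equally long perpendicular vector \<open>d\<close>.
\<close>

lemma quarter_turn_exists:
  "\<exists>J. linear J \<and> (\<forall>x. J (J x) = vneg x)"
proof -
  obtain e where e: "e \<noteq> origin" using lower_dimension by (metis bet_refl_left)
  obtain q where q: "\<not> collinear origin e q" using not_col_ex e by metis
  obtain P T where P: "perp P origin e" "P \<noteq> origin" using perp_exists_across[OF q] by metis
  obtain d where d: "bet (vneg P) origin d" "len origin d = len origin e" using extend .
  have dn: "d \<noteq> origin" using d(2) e by auto
  have "bet (vneg P) origin P" using half_turn_bet bet_sym vneg_def by metis
  then have "collinear (vneg P) origin P" "collinear (vneg P) origin d" using d unfolding collinear_def by auto
  then have "collinear origin P d" using col3[of "vneg P" origin origin P d] P by simp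
  then have pd: "perp d origin e" using perp_col perp_sym P by blast
  have nc: "\<not> collinear origin e d" using perp_not_col[OF pd e dn] .
  define m where "m = mid e d"
  have m: "m \<noteq> origin"
  proof
    assume "m = origin"
    then have "d = half_turn origin e" unfolding m_def by (metis half_turn_mid)
    then show False using nc half_turn_col col_swap by blast
  qed
  define F where "F = mirror origin m"
  define G where "G = mirror origin e"
  have lin: "linear F" "linear G" unfolding F_def G_def using linear_mirror m e by auto
  have Fe: "F e = d" unfolding F_def m_def using mirror_mid d(2) m m_def by simp
  then have Fd: "F d = e" unfolding F_def using m by (metis mirror_mirror)
  have Ge: "G e = e" "G d = vneg d" unfolding G_def using mirror_on_line mirror_perp e pd by auto
  define J where "J x = F (G x)" for x
  have J: "linear J" unfolding J_def using linear_comp[OF lin] .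
  have Je: "J e = d" "J d = vneg e" unfolding J_def by (simp_all add: Fe Fd Ge linear_neg[OF lin(1)])
  have JJ: "isometry (\<lambda>x. J (J x))" "J (J origin) = origin"
    using linear_comp[OF J J] linear_def by auto
  have "J (J x) = half_turn origin x" for x
    by (rule isometry_unique[OF JJ(1) isometry_half_turn nc])
       (use JJ Je linear_neg[OF J] in \<open>simp_all add: vneg_def\<close>)
  then show ?thesis using J vneg_def by auto
qed

definition J where "J = (SOME J. linear J \<and> (\<forall>x. J (J x) = vneg x))"

lemma linear_J: "linear J" and J_J [simp]: "J (J x) = vneg x"
  using someI_ex[OF quarter_turn_exists] unfolding J_def[symmetric] by auto

lemmas J_neg [simp] = linear_neg[OF linear_J] and J_origin [simp] = linear_origin[OF linear_J]
lemmas len_J = linear_len[OF linear_J]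

lemma J_eq_origin [simp]: "J x = origin \<longleftrightarrow> x = origin"
  by (metis J_J J_origin vneg_eq_origin)

lemma perp_J: "perp x origin (J x)"
proof -
  have "len x (J x) = len (J x) (vneg x)"
    using isometryD[of J x "J x"] linear_J unfolding linear_def by simp
  also have "\<dots> = len (vneg (J x)) x"
    using half_turn_iso[of origin "J x" "vneg x"] by (simp add: vneg_def)
  finally show ?thesis unfolding perp_def vneg_def by (simp only: len_commute)
qed

lemma J_not_col: "x \<noteq> origin \<Longrightarrow> \<not> collinear origin x (J x)"
  using perp_not_col[of "J x" x] perp_J perp_sym by simp

lemma perp_eq_J:
  assumes "perp y origin x" "len origin y = len origin x" "x \<noteq> origin"
  shows "y = J x \<or> y = vneg (J x)"
proof -
  have "collinear origin (J x) y" using perp_unique perp_J perp_sym assms(1,3) by metis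
  moreover have "len origin (J x) = len origin y" using len_J assms(2) by simp
  ultimately show ?thesis using on_line_equidistant vneg_def by metis
qed

text \<open>
  Orientation: an isometry about the origin preserves it iff it commutes with the quarter turn \<open>J\<close>, and
  reverses it iff it anticommutes with \<open>J\<close>.  This avoids all considerations of order.
\<close>

definition direct where "direct f \<longleftrightarrow> linear f \<and> (\<forall>x. f (J x) = J (f x))"
definition indirect where "indirect f \<longleftrightarrow> linear f \<and> (\<forall>x. f (J x) = vneg (J (f x)))"

lemma direct_linear: "direct f \<Longrightarrow> linear f" and indirect_linear: "indirect f \<Longrightarrow> linear f"
  by (simp_all add: direct_def indirect_def)

lemma vector_exists: "\<exists>e. e \<noteq> origin"
  using lower_dimension by (metis bet_refl_left)

text \<open>
  Only two vectors are perpendicular to \<open>f e\<close> and as long as \<open>f e\<close>, namely \<open>J (f e)\<close> and its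
  negative; so \<open>f J\<close> agrees with \<open>J f\<close> or with its negative at \<open>e\<close>, and then also at the
  origin and at \<open>J e\<close>.
\<close>

lemma direct_or_indirect:
  assumes f: "linear f" shows "direct f \<or> indirect f"
proof -
  obtain e where e: "e \<noteq> origin" using vector_exists by blast
  have fe: "f e \<noteq> origin" using f e by (metis linear_len len_eq_null)
  have iso: "isometry f" "isometry J" "isometry vneg" using f linear_J linear_vneg by (auto simp: linear_def)
  have i1: "isometry (\<lambda>x. f (J x))" and i2: "isometry (\<lambda>x. J (f x))"
    and i3: "isometry (\<lambda>x. vneg (J (f x)))" using iso isometry_comp by auto
  have "perp (f (J e)) origin (f e)"
    using isometry_perp[OF iso(1) perp_J, of e] perp_sym linear_origin[OF f] by simp
  moreover have "len origin (f (J e)) = len origin (f e)"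
    by (simp add: linear_len f linear_J)
  ultimately have "f (J e) = J (f e) \<or> f (J e) = vneg (J (f e))"
    using perp_eq_J fe by blast
  then show ?thesis
  proof
    assume h: "f (J e) = J (f e)"
    have "f (J x) = J (f x)" for x
      by (rule isometry_unique[OF i1 i2 J_not_col[OF e]])
         (simp_all add: h linear_origin[OF f] linear_neg[OF f])
    then show ?thesis using f by (simp add: direct_def)
  next
    assume h: "f (J e) = vneg (J (f e))"
    have "f (J x) = vneg (J (f x))" for x
      by (rule isometry_unique[OF i1 i3 J_not_col[OF e]])
         (simp_all add: h linear_origin[OF f] linear_neg[OF f])
    then show ?thesis using f by (simp add: indirect_def)
  qed
qed

lemma linear_eqI:
  assumes "linear f" "linear g" "e \<noteq> origin" "f e = g e" "f (J e) = g (J e)"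
  shows "f x = g x"
  using isometry_unique[OF _ _ J_not_col[OF assms(3)]] assms by (auto simp: linear_def)

lemma direct_eqI: "direct f \<Longrightarrow> direct g \<Longrightarrow> e \<noteq> origin \<Longrightarrow> f e = g e \<Longrightarrow> f x = g x"
  using linear_eqI by (simp add: direct_def)

lemma indirect_eqI: "indirect f \<Longrightarrow> indirect g \<Longrightarrow> e \<noteq> origin \<Longrightarrow> f e = g e \<Longrightarrow> f x = g x"
  using linear_eqI by (simp add: indirect_def)

lemma direct_id: "direct (\<lambda>x. x)"
  by (simp add: direct_def linear_def isometry_id)

lemma direct_J: "direct J"
  by (simp add: direct_def linear_J)

lemma direct_indirect: "direct f \<Longrightarrow> indirect g \<Longrightarrow> indirect (\<lambda>x. f (g x))"
  and indirect_direct: "indirect f \<Longrightarrow> direct g \<Longrightarrow> indirect (\<lambda>x. f (g x))"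
  and indirect_indirect: "indirect f \<Longrightarrow> indirect g \<Longrightarrow> direct (\<lambda>x. f (g x))"
  by (auto simp: direct_def indirect_def linear_comp linear_neg)

lemma indirect_mirror:
  assumes u: "u \<noteq> origin" shows "indirect (mirror origin u)"
proof (rule ccontr)
  assume "\<not> ?thesis"
  then have "direct (mirror origin u)" using direct_or_indirect linear_mirror u by blast
  then have "mirror origin u (J u) = J u"
    using direct_eqI[OF _ direct_id u] mirror_on_line u by simp
  then have "collinear origin u (J u)" using mirror_fix u by metis
  then show False using J_not_col u by simp
qed

lemma mirror_to:
  assumes "len origin v = len origin w" "v \<noteq> w"
  obtains u where "u \<noteq> origin" "mirror origin u v = w"
proof (cases "mid v w = origin")
  case False then show ?thesis using that mirror_mid[OF assms(1)] by blast
next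
  case True
  then have "w = vneg v" by (metis half_turn_mid vneg_def)
  moreover have "v \<noteq> origin" using assms by auto
  moreover then have "mirror origin (J v) v = vneg v" using mirror_perp perp_J by simp
  ultimately show ?thesis using that[of "J v"] by simp
qed

text \<open>
  The theorem of three reflections: an indirect isometry \<open>f\<close> agrees at some vector \<open>e\<close> with a
  reflection, which is indirect too, and therefore \<open>f\<close> is that reflection; if \<open>f\<close> fixes \<open>e\<close>,
  the direct isometry \<open>f f\<close> fixes \<open>e\<close>, so it is the identity.
\<close>

lemma indirect_involution:
  assumes f: "indirect f" shows "f (f x) = x"
proof -
  obtain e where e: "e \<noteq> origin" using vector_exists by blast
  show ?thesis
  proof (cases "f e = e")
    case True
    then show ?thesis using direct_eqI[OF indirect_indirect[OF f f] direct_id e] by simp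
  next
    case False
    have "len origin e = len origin (f e)" using linear_len indirect_linear f by simp
    then obtain u where u: "u \<noteq> origin" "mirror origin u e = f e" using mirror_to False by metis
    have "f x = mirror origin u x" for x
      using indirect_eqI[OF f indirect_mirror[OF u(1)] e] u(2) by simp
    then show ?thesis using u(1) by simp
  qed
qed

lemma direct_exists:
  assumes "len origin v = len origin w" "v \<noteq> origin"
  shows "\<exists>r. direct r \<and> r v = w"
proof (cases "v = w")
  case True then show ?thesis using direct_id by blast
next
  case False
  then obtain u where u: "u \<noteq> origin" "mirror origin u v = w" using mirror_to assms by metis
  have "direct (\<lambda>x. mirror origin u (mirror origin v x))"
    using indirect_indirect indirect_mirror u assms by blast
  moreover have "mirror origin u (mirror origin v v) = w" using u assms mirror_on_line by simp
  ultimately show ?thesis by blast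
qed

definition inverse_rotations where
  "inverse_rotations r s \<longleftrightarrow> direct r \<and> direct s \<and> (\<forall>x. r (s x) = x) \<and> (\<forall>x. s (r x) = x)"

lemma inverse_rotations_sym: "inverse_rotations r s \<Longrightarrow> inverse_rotations s r"
  by (simp add: inverse_rotations_def)

lemma inverse_rotation_exists: assumes r: "direct r" shows "\<exists>s. inverse_rotations r s"
proof -
  obtain e where e: "e \<noteq> origin" using vector_exists by blast
  let ?f = "mirror origin e"
  have f: "indirect ?f" using indirect_mirror e .
  have "?f (r (?f (r x))) = x" for x using indirect_involution[OF indirect_direct[OF f r]] .
  moreover have "r (?f (r (?f x))) = x" for x using indirect_involution[OF direct_indirect[OF r f]] .
  moreover have "direct (\<lambda>x. ?f (r (?f x)))" using indirect_indirect[OF indirect_direct[OF f r] f] .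
  ultimately have "inverse_rotations r (\<lambda>x. ?f (r (?f x)))" using r by (simp add: inverse_rotations_def)
  then show ?thesis by blast
qed

text \<open>
  \<open>f r\<close> is indirect, hence an involution; so conjugation by an indirect \<open>f\<close> inverts every rotation.
\<close>

lemma indirect_rotation:
  assumes "indirect f" "inverse_rotations r s" shows "f (r x) = s (f x)"
proof -
  have r: "direct r" and i: "\<And>x. r (s x) = x" using assms(2) by (auto simp: inverse_rotations_def)
  have "f (r (f (r (s (f x))))) = s (f x)" using indirect_involution[OF indirect_direct[OF assms(1) r]] .
  then show ?thesis using i indirect_involution[OF assms(1)] by simp
qed

text \<open>
  The rotation \<open>r\<close> is the product of the two indirect isometries \<open>f\<close> and \<open>f r\<close>.  Each of them
  inverts \<open>s\<close> when \<open>s\<close> is moved past it, so together they leave \<open>s\<close> unchanged.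
\<close>

lemma direct_commute:
  assumes r: "direct r" and s: "direct s" shows "r (s x) = s (r x)"
proof -
  obtain e where e: "e \<noteq> origin" using vector_exists by blast
  let ?f = "mirror origin e"
  have f: "indirect ?f" using indirect_mirror e .
  obtain t where t: "inverse_rotations s t" using inverse_rotation_exists s by blast
  have ff: "?f (?f y) = y" for y using indirect_involution[OF f] .
  have "s (r x) = s (?f (?f (r x)))" by (simp add: ff)
  also have "\<dots> = ?f (t (?f (r x)))" using indirect_rotation[OF f inverse_rotations_sym[OF t]] by simp
  also have "\<dots> = ?f (?f (r (s x)))" using indirect_rotation[OF indirect_direct[OF f r] t] by simp
  finally show ?thesis by (simp add: ff)
qed

text \<open>
  The points of the line are the fixed points of an additive map, the reflection in the line.
\<close>

lemma line_closed_sub: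
  assumes c: "c \<noteq> origin" and x: "collinear origin c x" and y: "collinear origin c y"
  shows "collinear origin c (vsub x y)"
proof -
  have "mirror origin c (vsub x y) = vsub x y"
    using mirror_on_line[OF c[symmetric]] linear_sub[OF linear_mirror[OF c]] x y by simp
  then show ?thesis using mirror_fix[OF c[symmetric]] by simp
qed

text \<open>
  The perpendicular to the line at \<open>m = w / 2\<close> meets the circle about the origin through \<open>v\<close> in a point
  \<open>X = r v\<close>, because \<open>m\<close> is inside the circle.  The mirror image of \<open>X\<close> in the line is \<open>s v\<close>, and
  \<open>m\<close> is the midpoint of these two points.  For \<open>w = 0\<close> the two quarter turns serve.
\<close>

lemma sum_of_inverse_rotations:
  assumes v: "v \<noteq> origin" and c: "collinear origin v w" and E: "bet origin w E" "len origin E = len origin v"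
  obtains r s where "inverse_rotations r s" "w = vadd (r v) (s v)"
proof (cases "w = origin")
  case True
  have "direct (\<lambda>x. vneg (J x))" using direct_J linear_vneg linear_comp by (simp add: direct_def)
  then have "inverse_rotations J (\<lambda>x. vneg (J x))" using direct_J by (simp add: inverse_rotations_def)
  then show ?thesis using that True V.add.right_inverse by simp
next
  case False
  define m where "m = half w"
  have mO: "m \<noteq> origin" using m_def False by simp
  have bm: "bet origin m w" unfolding m_def half_def by (rule bet_mid)
  have dm: "half_turn m origin = w" unfolding m_def half_def by simp
  have mw: "m \<noteq> w" using dm mO by (metis half_turn_fix half_turn_half_turn)
  have bE: "bet origin m E" using bet_trans'[OF bm E(1)] .
  have mE: "m \<noteq> E" using E(1) bm mw bet_antisym bet_sym by blast
  define Q where "Q = vadd m (J m)"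
  have Qm: "m \<noteq> Q" using mO unfolding Q_def by (metis J_eq_origin V.add_left_cancel vadd_origin(2))
  have "perp (vneg m) origin (J m)" using perp_half_turn perp_J perp_sym vneg_def by metis
  then have "perp (vadd m (vneg m)) (vadd m origin) (vadd m (J m))" using isometry_perp[OF isometry_vadd] by blast
  then have pQ: "perp origin m Q" unfolding Q_def by simp
  obtain X where X: "cong origin X origin E" "bet m Q X \<or> bet Q X m \<or> bet X m Q"
    using line_circle_continuity[OF bE mE Qm] by blast
  have "collinear m Q X" using X(2) unfolding collinear_def by blast
  then have pX: "perp X m origin" using perp_col[OF pQ] Qm perp_sym by auto
  have cm: "collinear origin v m" using col_between_on_line[OF v[symmetric] _ c bm] by simp
  have "foot origin v X = m" using foot_eqI[OF v[symmetric] cm _ _ pX] mO by simp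
  then have sX: "mirror origin v X = half_turn m X" by (simp add: mirror_def)
  have "len origin v = len origin X" using X(1) E(2) cong_iff_len by simp
  then obtain r where r: "direct r" "r v = X" using direct_exists v by metis
  obtain s where s: "inverse_rotations r s" using inverse_rotation_exists r by blast
  have "s v = mirror origin v X"
    using indirect_rotation[OF indirect_mirror[OF v] s, of v] r(2) mirror_on_line v by simp
  then have "vadd (r v) (s v) = w" using r(2) sX dm by (simp add: vadd_def)
  then show ?thesis using that s by blast
qed

lemma compare_lengths:
  "\<exists>E. (bet origin w E \<and> len origin E = len origin v) \<or> (bet origin v E \<and> len origin E = len origin w)"
proof (cases "w = origin")
  case True then show ?thesis using bet_refl_left by blast
next
  case False
  obtain E where E: "bet (vneg w) origin E" "len origin E = len origin v" using extend .
  have "bet (vneg w) origin w" using half_turn_bet bet_sym vneg_def by metis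
  then consider "bet origin w E" | "bet origin E w" using bet_connect[OF _ E(1)] False by fastforce
  then show ?thesis
  proof cases
    case 1 then show ?thesis using E by blast
  next
    case 2
    obtain D where D: "bet origin v D" "len v D = len E w" using extend .
    have "len origin D = len origin w" using len_add[OF D(1) 2] D(2) E(2) by simp
    then show ?thesis using D by blast
  qed
qed

text \<open>
  For \<open>w = r v + s v\<close> with inverse rotations \<open>r, s\<close>, the reflection in the line of \<open>T v\<close>
  exchanges \<open>r (T v)\<close> with \<open>s (T v)\<close> and so fixes their sum \<open>T w\<close>.
\<close>

lemma rotation_commuting_preserves_lines:
  assumes add: "\<And>x y. T (vadd x y) = vadd (T x) (T y)"
    and comm: "\<And>r x. direct r \<Longrightarrow> T (r x) = r (T x)"
    and nz: "\<And>x. x \<noteq> origin \<Longrightarrow> T x \<noteq> origin"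
    and vw: "v \<noteq> origin" "w \<noteq> origin" "collinear origin v w"
  shows "collinear origin (T v) (T w)"
proof -
  have *: "collinear origin (T x) (T y)"
    if xy: "x \<noteq> origin" "collinear origin x y" "bet origin y E" "len origin E = len origin x" for x y E
  proof -
    obtain r s where rs: "inverse_rotations r s" "y = vadd (r x) (s x)"
      using sum_of_inverse_rotations[OF xy] .
    have d: "direct r" "direct s" using rs(1) by (auto simp: inverse_rotations_def)
    have Ty: "T y = vadd (r (T x)) (s (T x))" by (simp add: rs(2) add comm d)
    have Tx: "T x \<noteq> origin" using nz xy(1) .
    have f: "indirect (mirror origin (T x))" using indirect_mirror[OF Tx] .
    have "mirror origin (T x) (T y) = vadd (s (T x)) (r (T x))"
      unfolding Ty linear_add[OF indirect_linear[OF f]]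
      using indirect_rotation[OF f rs(1), of "T x"] indirect_rotation[OF f inverse_rotations_sym[OF rs(1)], of "T x"]
        mirror_on_line[OF Tx[symmetric]] by simp
    then have "mirror origin (T x) (T y) = T y" unfolding Ty by (simp only: vadd_commute)
    then show ?thesis using mirror_fix[OF Tx[symmetric]] by simp
  qed
  obtain E where "(bet origin w E \<and> len origin E = len origin v) \<or> (bet origin v E \<and> len origin E = len origin w)"
    using compare_lengths by blast
  then show ?thesis
  proof
    assume "bet origin w E \<and> len origin E = len origin v"
    then show ?thesis using * vw by blast
  next
    assume "bet origin v E \<and> len origin E = len origin w"
    moreover have "collinear origin w v" using vw(3) col_rot col_swap by blast
    ultimately have "collinear origin (T w) (T v)" using * vw by blast
    then show ?thesis using col_rot col_swap by blast
  qed
qed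

lemma right_angleI:
  assumes "perp X Y Z" "X \<noteq> Y" "Y \<noteq> Z" shows "right_angle X Y Z"
proof -
  have "half_turn Y X \<noteq> Y" using assms(2) by simp
  from half_turn_bet assms(2) this[symmetric] have "between X Y (half_turn Y X)"
    unfolding between_def by (intro conjI)
  moreover have "cong X Y (half_turn Y X) Y"
    by (rule iffD2[OF cong_iff_len]) (rule len_flip[OF half_turn_len, symmetric])
  moreover have "cong X Z (half_turn Y X) Z"
  proof -
    have "len Z X = len Z (half_turn Y X)" using assms(1) perp_sym unfolding perp_def by blast
    then have "len X Z = len (half_turn Y X) Z" by (rule len_flip)
    then show ?thesis by (rule iffD2[OF cong_iff_len])
  qed
  ultimately show ?thesis using assms(3) unfolding right_angle_def by blast
qed
end

context pointed_plane begin

section \<open>The circumscribed rectangles of a triangle\<close>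

lemma rectangleI:
  assumes pq: "perp q origin p" "p \<noteq> origin" "q \<noteq> origin"
    and Q: "Q = vadd u p" and R: "R = vadd Q q" and S: "S = vadd u q"
  shows "rectangle u Q R S"
proof -
  have ra: "right_angle (vadd w x) w (vadd w y)" if "perp x origin y" "x \<noteq> origin" "y \<noteq> origin" for w x y
  proof -
    have "perp (vadd w x) (vadd w origin) (vadd w y)" using isometry_perp[OF isometry_vadd that(1)] .
    then show ?thesis using right_angleI that(2,3) by simp
  qed
  have pr: "perp p origin q" "perp (vneg p) origin q" "perp (vneg q) origin (vneg p)" "perp p origin (vneg q)"
    using pq(1) perp_half_turn perp_sym unfolding vneg_def by blast+
  have RS: "R = vadd S p" unfolding Q R S by (simp only: V.add.assoc V.add.commute[of p q])
  have e: "vadd Q (vneg p) = u" "vadd R (vneg q) = Q" "vadd R (vneg p) = S" "vadd S (vneg q) = u"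
  proof -
    show "vadd Q (vneg p) = u" unfolding Q by simp
    show "vadd R (vneg q) = Q" unfolding R by simp
    show "vadd R (vneg p) = S" unfolding RS by simp
    show "vadd S (vneg q) = u" unfolding S by simp
  qed
  show ?thesis unfolding rectangle_def
    using ra[OF pq(1,3,2), of u] ra[OF pr(2), of Q] ra[OF pr(3), of R] ra[OF pr(4), of S]
      pq(2,3) e Q R S RS by simp
qed

lemma vec_cancel: "vadd x (vsub y x) = y"
  by (simp only: vsub_def V.add.left_commute[of x y] V.add.right_inverse vadd_origin)

lemma not_opposite_translate:
  assumes c: "c \<noteq> origin" and p: "collinear origin c p"
  shows "\<not> opposite origin c x (vadd x p)"
proof
  assume "opposite origin c x (vadd x p)"
  then obtain z where x: "\<not> collinear origin c x" and z: "collinear origin c z" "bet x z (vadd x p)"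
    unfolding opposite_def by blast
  have "(\<lambda>y. vsub y x) = vadd (vneg x)" by (rule ext, simp only: vsub_def, rule vadd_commute)
  then have "isometry (\<lambda>y. vsub y x)" using isometry_vadd by simp
  then have "bet (vsub x x) (vsub z x) (vsub (vadd x p) x)" using isometry_bet z(2) by metis
  then have "bet origin (vsub z x) p" by simp
  then have "collinear origin c (vsub z x)" using col_between_on_line[OF c[symmetric] col_refl(3) p] by blast
  then have "collinear origin c (vsub z (vsub z x))" using line_closed_sub[OF c z(1)] by blast
  then show False using x by (simp add: V.diff_diff_eq2)
qed

text \<open>
  Vectors that move points along the line do not change the sides on which the points lie.
\<close>

lemma opposite_translate:
  assumes c: "c \<noteq> origin" and p: "collinear origin c p" "collinear origin c q"
    and xy: "\<not> collinear origin c x" "\<not> collinear origin c y"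
    and o: "opposite origin c (vadd x p) (vadd y q)"
  shows "opposite origin c x y"
proof -
  have "opposite origin c x (vadd y q)"
    using pasch[OF c[symmetric] o xy(1)] not_opposite_translate[OF c p(1)] opposite_sym by blast
  then show ?thesis
    using pasch[OF c[symmetric] _ xy(2)] not_opposite_translate[OF c p(2)] opposite_sym by blast
qed

lemma bet_origin_or_vneg:
  assumes "collinear origin x y" "x \<noteq> origin"
  shows "bet x origin y \<or> bet (vneg x) origin y"
proof -
  have n: "bet (vneg x) origin x" using half_turn_bet bet_sym vneg_def by metis
  consider "bet x origin y" | "bet origin x y" | "bet origin y x"
    using assms(1) bet_sym unfolding collinear_def by blast
  then show ?thesis
  proof cases
    case 2 then show ?thesis using bet_outer_trans'[OF n 2] assms(2) by blast
  next
    case 3 then show ?thesis using bet_inner_trans[OF n 3] by blast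
  qed simp
qed

lemma mirror_vneg_perp:
  assumes c: "c \<noteq> origin" and x: "mirror origin c x = vneg x" and y: "collinear origin c y"
  shows "perp x origin y"
proof -
  have "len y x = len y (vneg x)" using mirror_equidistant[OF c[symmetric] y, of x] x by simp
  then have "perp y origin x" unfolding perp_def vneg_def .
  then show ?thesis using perp_sym by blast
qed

text \<open>
  The common corner of the four quadrants is placed at the vertex \<open>B\<close>, taken as origin, with one side
  along \<open>BC\<close>.
\<close>

theorem equal_triangles_rotate:
  assumes tri: "\<not> collinear A origin C"
  shows "equal_triangles A origin C origin C A"
proof -
  have A: "A \<noteq> origin" and C: "C \<noteq> origin" using tri by auto
  have nA: "\<not> collinear origin C A" using tri col_rot col_swap by blast
  \<comment> \<open>\<open>v\<close> is on the ray from the origin through \<open>C\<close>, as long as \<open>A\<close>.\<close>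
  obtain v where v: "bet (vneg C) origin v" "len origin v = len origin A" using extend .
  have v0: "v \<noteq> origin" using v(2) A by auto
  have Cv: "collinear origin C v"
  proof -
    have "bet (vneg C) origin C" using half_turn_bet bet_sym vneg_def by metis
    then have "collinear (vneg C) origin C" "collinear (vneg C) origin v" using v(1) unfolding collinear_def by auto
    then show ?thesis using col3[of "vneg C" origin origin C v] C by simp
  qed
  have vC: "collinear origin v C" using Cv col_rot col_swap by blast
  have lv: "collinear origin v x \<longleftrightarrow> collinear origin C x" for x
    using line_eq[OF C[symmetric] v0[symmetric] _ Cv] by simp
  have nvC: "\<not> bet v origin C"
  proof
    assume "bet v origin C"
    moreover have "bet v origin (vneg C)" using v(1) bet_sym by blast
    moreover have "len origin C = len origin (vneg C)" by (simp add: vneg_def half_turn_len)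
    ultimately have "C = vneg C" using extend_unique[OF v0] by blast
    then show False using C by (metis vneg_fix)
  qed
  obtain r where r: "direct r" "r v = A" using direct_exists[OF v(2) v0] by blast
  obtain s where rs: "inverse_rotations r s" using inverse_rotation_exists[OF r(1)] by blast
  have ds: "direct s" using rs by (simp add: inverse_rotations_def)
  note linr = direct_linear[OF r(1)] and lins = direct_linear[OF ds]
  define g where "g = mirror origin C"
  have gi: "indirect g" unfolding g_def using indirect_mirror C by blast
  note ling = indirect_linear[OF gi]
  have gC: "g x = x \<longleftrightarrow> collinear origin C x" for x unfolding g_def using mirror_fix[OF C[symmetric]] .
  \<comment> \<open>\<open>f\<close> is the reflection in the bisector of the angle at the origin; it exchanges \<open>v\<close> with \<open>A\<close> and \<open>C\<close> with \<open>r C\<close>.\<close>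
  define f where "f x = r (g x)" for x
  have fi: "indirect f" unfolding f_def using direct_indirect[OF r(1) gi] .
  note linf = indirect_linear[OF fi]
  have ff: "f (f x) = x" for x using indirect_involution[OF fi] .
  have isof: "isometry f" using linf linear_def by blast
  have fv: "f v = A" "f A = v"
  proof -
    show "f v = A" unfolding f_def using gC Cv r(2) by metis
    then show "f A = v" using ff[of v] by simp
  qed
  have fC: "f C = r C" "f (r C) = C"
  proof -
    show "f C = r C" unfolding f_def using gC[of C] by simp
    then show "f (r C) = C" using ff[of C] by simp
  qed
  define N where "N x = half (vsub (r x) (s x))" for x
  define U where "U x = vadd x (N x)" for x
  have gr: "g (r x) = s (g x)" "g (s x) = r (g x)" for x
    using indirect_rotation[OF gi rs] indirect_rotation[OF gi inverse_rotations_sym[OF rs]] by auto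
  \<comment> \<open>On the line of \<open>C\<close>, where \<open>s x\<close> is the mirror image of \<open>r x\<close>, the vectors \<open>P x\<close> and \<open>N x\<close> are the components of \<open>r x\<close> along the line and perpendicular to it.\<close>
  define P where "P x = half (vadd (r x) (s x))" for x
  have PN: "r x = vadd (P x) (N x)" for x
  proof -
    have "vadd (P x) (N x) = half (vadd (vadd (r x) (s x)) (vsub (r x) (s x)))"
      unfolding P_def N_def half_add ..
    also have "vadd (vadd (r x) (s x)) (vsub (r x) (s x)) = vadd (r x) (r x)"
      by (simp only: V.add.assoc vec_cancel)
    finally show ?thesis by (simp add: double_half)
  qed
  have Pline: "collinear origin C (P x)" if "collinear origin C x" for x
  proof -
    have "g x = x" using that gC by blast
    then have "g (P x) = P x" unfolding P_def linear_half[OF ling] linear_add[OF ling] gr by (simp add: vadd_commute)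
    then show ?thesis using gC by blast
  qed
  have Nneg: "g (N x) = vneg (N x)" if "collinear origin C x" for x
  proof -
    have "g x = x" using that gC by blast
    then have "g (N x) = half (vsub (s x) (r x))"
      unfolding N_def linear_half[OF ling] linear_sub[OF ling] gr by simp
    also have "\<dots> = half (vneg (vsub (r x) (s x)))" by simp
    also have "\<dots> = vneg (N x)" unfolding N_def linear_half[OF linear_vneg] ..
    finally show ?thesis .
  qed
  have Nperp: "perp (N x) origin y" if "collinear origin C x" "collinear origin C y" for x y
    using mirror_vneg_perp[OF C _ that(2)] Nneg[OF that(1)] g_def by simp
  have Noff: "N x \<noteq> origin" if "x \<noteq> origin" "collinear origin C x" for x
  proof
    assume "N x = origin"
    then have "collinear origin C (r x)" using PN[of x] Pline[OF that(2)] by simp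
    moreover have "collinear origin A (r x)"
      using isometry_col[of r origin v x] linr r(2) lv that(2) unfolding linear_def by auto
    moreover have "r x \<noteq> origin" using that(1) linear_len[OF linr, of x] by (metis len_eq_null)
    ultimately have "collinear origin C A" using col_unique[of origin C A "r x"] by blast
    then show False using nA by simp
  qed
  \<comment> \<open>\<open>n2\<close> is the height from \<open>A\<close>, \<open>e\<close> the height of \<open>r C\<close> over the line of \<open>C\<close>, and its mirror image \<open>n1\<close> the height from \<open>C\<close> over the line of \<open>A\<close>.\<close>
  define e where "e = N C"
  define n2 where "n2 = N v"
  define n1 where "n1 = f e"
  have OC: "collinear origin C C" by simp
  have e0: "e \<noteq> origin" and n20: "n2 \<noteq> origin" unfolding e_def n2_def using Noff C v0 Cv by auto
  have n10: "n1 \<noteq> origin" unfolding n1_def using e0 linear_len[OF linf, of e] by (metis len_eq_null)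
  have pe: "perp e origin y" and pn2: "perp n2 origin y" if "collinear origin C y" for y
    unfolding e_def n2_def using Nperp that Cv OC by auto
  have pn1: "perp n1 origin A"
    using isometry_perp[OF isof pe[OF Cv]] fv linear_origin[OF linf] n1_def by simp
  have A_eq: "A = vadd (P v) n2" using PN[of v] r(2) n2_def by simp
  have rC_eq: "r C = vadd (P C) e" using PN[of C] e_def by simp
  have C_eq: "C = vadd (f (P C)) n1"
    using fC(2) unfolding rC_eq linear_add[OF linf] n1_def by simp
  have col_f: "collinear origin A (f (P C))"
    using isometry_col[OF isof, of origin v "P C"] lv Pline[OF OC] fv linear_origin[OF linf] by simp

  \<comment> \<open>\<open>x\<close> and \<open>N x\<close> are perpendicular, so they cannot cancel.\<close>
  have Unz: "U x \<noteq> origin" if "x \<noteq> origin" for x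
  proof
    assume "U x = origin"
    then have N: "N x = vneg x" unfolding U_def by (metis V.minus_unique)
    have h: "indirect (mirror origin x)" using indirect_mirror[OF that] .
    have "mirror origin x (N x) = half (vsub (s x) (r x))"
      unfolding N_def linear_half[OF indirect_linear[OF h]] linear_sub[OF indirect_linear[OF h]]
        indirect_rotation[OF h rs] indirect_rotation[OF h inverse_rotations_sym[OF rs]]
      using mirror_on_line[OF that[symmetric]] by simp
    also have "\<dots> = half (vneg (vsub (r x) (s x)))" by simp
    also have "\<dots> = vneg (N x)" unfolding N_def linear_half[OF linear_vneg] ..
    finally have "mirror origin x (vneg x) = x" using N by simp
    moreover have "mirror origin x (vneg x) = vneg x"
      using linear_neg[OF indirect_linear[OF h]] mirror_on_line[OF that[symmetric]] by simp
    ultimately show False using that by simp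
  qed
  have UC: "collinear origin (U v) (U C)"
  proof (rule rotation_commuting_preserves_lines[OF _ _ _ v0 C vC])
    show "U (vadd x y) = vadd (U x) (U y)" for x y
    proof -
      have "vsub (vadd a b) (vadd c d) = vadd (vsub a c) (vsub b d)" for a b c d
        by (simp only: vsub_def linear_add[OF linear_vneg] V.add.assoc V.add.left_commute)
      then show ?thesis unfolding U_def N_def linear_add[OF linr] linear_add[OF lins]
        by (simp only: half_add V.add.assoc V.add.left_commute)
    qed
    show "U (t x) = t (U x)" if t: "direct t" for t x
      unfolding U_def N_def direct_commute[OF r(1) t] direct_commute[OF ds t]
      by (simp only: linear_add linear_half linear_sub direct_linear[OF t])
  qed (rule Unz)

  have off: "\<not> collinear origin C A" "\<not> collinear origin C (r C)"
  proof -
    show "\<not> collinear origin C A" using nA .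
    show "\<not> collinear origin C (r C)"
    proof
      assume "collinear origin C (r C)"
      moreover have "collinear origin A (r C)"
        using isometry_col[of r origin v C] linr r(2) vC unfolding linear_def by auto
      moreover have "r C \<noteq> origin" using C linear_len[OF linr, of C] by (metis len_eq_null)
      ultimately show False using col_unique[OF nA] by blast
    qed
  qed
  have ne: "collinear origin n2 e" using perp_unique[OF pn2[OF OC] pe[OF OC]] C by simp
  \<comment> \<open>The heights of \<open>A\<close> and \<open>r C\<close>, which lie on one ray, point to the same side of the line of \<open>C\<close>.\<close>
  have opp: "bet (vneg n2) origin e"
  proof (rule ccontr)
    assume "\<not> ?thesis"
    then have b: "bet n2 origin e" using bet_origin_or_vneg[OF ne n20] by blast
    have noff: "\<not> collinear origin C n2" "\<not> collinear origin C e"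
      using perp_not_col[OF pn2[OF OC] C n20] perp_not_col[OF pe[OF OC] C e0] by auto
    have "opposite origin C n2 e" unfolding opposite_def using noff b col_refl(3) by blast
    moreover have "n2 = vadd A (vneg (P v))" "e = vadd (r C) (vneg (P C))"
      unfolding A_eq rC_eq by (simp_all add: vadd_commute)
    moreover have "collinear origin C (vneg (P v))" "collinear origin C (vneg (P C))"
      using line_closed_sub[OF C col_refl(3) Pline[OF Cv]] line_closed_sub[OF C col_refl(3) Pline[OF OC]]
      by simp_all
    ultimately have "opposite origin C A (r C)" using opposite_translate[OF C _ _ off] by metis
    then obtain z where z: "collinear origin C z" "bet A z (r C)" unfolding opposite_def by blast
    have "collinear origin A (r C)"
      using isometry_col[of r origin v C] linr r(2) vC unfolding linear_def by auto
    then have "collinear origin A z" using col_between_on_line[OF A[symmetric] _ _ z(2)] by simp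
    then have "z = origin" using col_unique[OF nA] z(1) by blast
    then have "bet A origin (r C)" using z by simp
    then have "bet v origin C" using isometry_bet[OF isof] fv fC linear_origin[OF linf] by metis
    then show False using nvC by simp
  qed

  \<comment> \<open>\<open>U v\<close> and \<open>U C\<close> lie on the same side of the line of \<open>e\<close>, because \<open>v\<close> and \<open>C\<close> do.\<close>
  have diag: "bet (vneg (U v)) origin (U C)"
  proof (rule ccontr)
    have pve: "perp v origin e" "perp C origin e" using pe[OF Cv] pe[OF OC] perp_sym by auto
    have xoff: "\<not> collinear origin e v" "\<not> collinear origin e C"
      using perp_not_col[OF pve(1) e0 v0] perp_not_col[OF pve(2) e0 C] by auto
    have en2: "collinear origin e n2" using ne col_rot col_swap by blast
    have shift: "\<not> collinear origin e (vadd x p)" if "\<not> collinear origin e x" "collinear origin e p" for x p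
    proof
      assume "collinear origin e (vadd x p)"
      then have "collinear origin e (vsub (vadd x p) p)" using line_closed_sub[OF e0] that(2) by blast
      then show False using that(1) by simp
    qed
    have Uv: "U v = vadd v n2" and UC': "U C = vadd C e" by (simp_all only: U_def n2_def e_def)
    have Uoff: "\<not> collinear origin e (U v)" "\<not> collinear origin e (U C)"
      unfolding Uv UC' using shift xoff en2 by auto
    then have "U v \<noteq> origin" by auto
    moreover assume "\<not> ?thesis"
    ultimately have "bet (U v) origin (U C)" using bet_origin_or_vneg[OF UC] by blast
    then have "opposite origin e (vadd v n2) (vadd C e)"
      unfolding opposite_def using Uoff col_refl(3) Uv UC' by metis
    then have "opposite origin e v C" using opposite_translate[OF e0 en2 col_refl(2) xoff] by blast
    then obtain z where z: "collinear origin e z" "bet v z C" unfolding opposite_def by blast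
    have "collinear origin C z" using col_between_on_line[OF C[symmetric] Cv _ z(2)] by simp
    moreover have "\<not> collinear origin C e" using perp_not_col[OF pe[OF OC] C e0] .
    ultimately have "z = origin" using col_unique z(1) by blast
    then show False using z nvC by simp
  qed
  have neg: "perp (vneg x) origin y" "perp x origin (vneg y)" if "perp x origin y" for x y
    using that perp_half_turn perp_sym unfolding vneg_def by blast+
  have lneg: "len origin (vneg x) = len origin x" for x by (simp add: vneg_def half_turn_len)
  have transl: "collinear (vadd x w) (vadd y w) (vadd z w)" if "collinear x y z" for x y z w
    using isometry_col[OF isometry_vadd that, of w] by (simp only: vadd_commute)

  have rect1: "rectangle A origin n1 (vadd A n1)"
    by (rule rectangleI[of n1 "vneg A"]) (simp_all add: neg pn1 A n10)
  have "collinear C n1 (vadd A n1)"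
    using transl[of "f (P C)" origin A n1] col_f C_eq col_rot col_swap by (metis vadd_origin(1))
  then have circ1: "first_circumscribed_rectangle A origin C n1 (vadd A n1)"
    unfolding first_circumscribed_rectangle_def triangle_def using tri rect1 by blast
  have rect2: "rectangle origin C (vadd C n2) n2"
    by (rule rectangleI[of n2 C]) (simp_all add: pn2 C n20)
  have "collinear A (vadd C n2) n2"
    using transl[of "P v" C origin n2] Pline[OF Cv] A_eq col_rot col_swap by (metis vadd_origin(1))
  then have circ2: "first_circumscribed_rectangle origin C A (vadd C n2) n2"
    unfolding first_circumscribed_rectangle_def triangle_def using nA rect2 by blast
  \<comment> \<open>The four rectangles at the origin, named as in the definition of equal rectangles.\<close>
  let ?E = e and ?G = "vneg v" and ?F = "vadd e (vneg v)" and ?M = C and ?A = "vneg n2"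
  let ?L = "vadd C (vneg n2)" and ?K = "vadd C e" and ?H = "vadd (vneg n2) (vneg v)"
  have r1: "rectangle ?F ?E origin ?G"
  proof (rule rectangleI[of "vneg e" v])
    show "vneg v = vadd ?F (vneg e)"
      by (simp only: V.add.commute[of e] V.add.assoc V.add.right_inverse vadd_origin)
  qed (simp_all add: neg pe Cv v0 e0)
  have r2: "rectangle origin ?M ?L ?A"
    by (rule rectangleI[of "vneg n2" C]) (simp_all add: neg pn2 C n20 )
  have r3: "rectangle ?A origin ?G ?H"
    by (rule rectangleI[of "vneg v" n2]) (use neg pn2[OF Cv] perp_sym v0 n20 in auto)
  have r4: "rectangle origin ?M ?K ?E"
    by (rule rectangleI[of e C]) (simp_all add: pe C e0 )
  have "congruent_rectangles A origin n1 (vadd A n1) ?F ?E origin ?G"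
  proof -
    have "len A origin = len ?F ?E"
    proof -
      have "len ?F ?E = len origin v" unfolding len_vec[of ?F] by (simp add: V.diff_diff_eq2)
      then show ?thesis using v(2) len_commute by metis
    qed
    moreover have "len origin n1 = len ?E origin"
      using linear_len[OF linf, of e] n1_def len_commute by metis
    ultimately show ?thesis unfolding congruent_rectangles_def
      by (intro conjI iffD2[OF cong_iff_len] rect1 r1)
  qed
  moreover have "congruent_rectangles origin C (vadd C n2) n2 origin ?M ?L ?A"
  proof -
    have "len C (vadd C n2) = len ?M ?L"
    proof -
      have "vsub ?L C = vneg n2"
        by (simp only: vsub_def V.add.commute[of C] V.add.assoc V.add.right_inverse vadd_origin)
      then show ?thesis unfolding len_vec[of C] by (simp only: lneg V.add_diff_cancel_left')
    qed
    then show ?thesis unfolding congruent_rectangles_def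
      by (intro conjI iffD2[OF cong_iff_len] rect2 r2 refl)
  qed
  moreover have "between ?A origin ?E" unfolding between_def using opp e0 n20 by auto
  moreover have "between ?G origin ?M"
  proof -
    have "bet (vneg (vneg C)) (vneg origin) (vneg v)"
      using isometry_bet[OF _ v(1)] linear_vneg unfolding linear_def by blast
    then show ?thesis unfolding between_def using bet_sym v0 C by auto
  qed
  moreover have "between ?H origin ?K"
  proof -
    have "vneg (U v) = ?H" unfolding U_def n2_def linear_add[OF linear_vneg] by (rule vadd_commute)
    moreover have "U C = ?K" unfolding U_def e_def ..
    ultimately have "bet ?H origin ?K" using diag by metis
    moreover have "?H \<noteq> origin" "?K \<noteq> origin"
      using Unz[OF v0] Unz[OF C] vneg_eq_origin \<open>vneg (U v) = ?H\<close> \<open>U C = ?K\<close> by metis+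
    ultimately show ?thesis unfolding between_def by auto
  qed
  ultimately have "equal_rectangles A origin n1 (vadd A n1) origin C (vadd C n2) n2"
    unfolding equal_rectangles_def using r3 r4 by blast
  then show ?thesis unfolding equal_triangles_def using circ1 circ2 by blast
qed

end

theorem theorem6p1:
  fixes bet :: "'p \<Rightarrow> 'p \<Rightarrow> 'p \<Rightarrow> bool"
    and cong :: "'p \<Rightarrow> 'p \<Rightarrow> 'p \<Rightarrow> 'p \<Rightarrow> bool"
    and A B C :: 'p
  assumes "euclidean_plane bet cong"
    and "euclidean_plane.triangle bet A B C"
  shows "euclidean_plane.equal_triangles bet cong A B C B C A"
proof -
  interpret euclidean_plane bet cong by fact
  interpret pointed_plane bet cong B by unfold_locales
  show ?thesis using equal_triangles_rotate assms(2) by (simp add: triangle_def)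
qed

end
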